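(* Fix a class of instances $(q,B)$ satisfying the serializability assumption with constants $c_{\min},c_{\max}>0$. Let $(q,B)$ be in this class, where $B$ is a finite effectively listable premise base with $m=|B|$, and $q\in\mathrm{Cn}(B)$ is derivable with $d:=\mathrm{Dd}(q\mid B)\ge 1$. Put $L:=d\log(m+d)$ and assume $\log m\le d\le\mathrm{poly}(m)$. (i) (Upper bound, all queries.) There is a constant $c_1>0$, depending only on $\mathcal P$, $U$, the encoding conventions and the serializability constants, such that $$K(q\mid\langle B\rangle)\le c_1\,d\log(m+d)=c_1L,$$ equivalently $\mathrm{Dd}(q\mid B)\ge \dfrac{K(q\mid\langle B\rangle)}{c_1\log(m+\mathrm{Dd}(q\mid B))}$. (ii) (Generic lower bound under richness.) Suppose $\mathcal P$ satisfies the richness condition with parameter $\delta_0>0$. Let $n:=N(q\mid B)$ and assume $q$ is generic/incompressible at its step-length scale, i.e. $K(q\mid\langle B\rangle)\ge(1-\delta)\,n\log(m+n)$ for some $\delta>\delta_0$. Then there is a constant $c_2>0$ such that $$\mathrm{Dd}(q\mid B)\le\frac{K(q\mid\langle B\rangle)}{c_2(1-\delta)\log(m+\mathrm{Dd}(q\mid B))}.$$ Consequently, for generic/incompressible queries (in the sense of (ii)), $$\mathrm{Dd}(q\mid B)=\Theta\!\left(\frac{K(q\mid\langle B\rangle)}{\log(m+\mathrm{Dd}(q\mid B))}\right),$$ equivalently $H_{\mathrm{derive}}(q\mid B)=\Theta\!\left(\dfrac{H_K(q\mid B)}{\log(m+\mathrm{Dd}(q\mid B))}\right)$, and equivalently $K(q\mid\langle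 B\rangle)=\Theta\bigl(\mathrm{Dd}(q\mid B)\log(m+\mathrm{Dd}(q\mid B))\bigr)$.
   Context: $\log=\log_2$; $\mathrm{poly}(m)$ denotes a fixed polynomial bound; constants do not depend on the particular instance $(q,B)$. $\mathcal L$ is many-sorted FO(LFP) (first-order logic with least fixed points) over finite structures. $\mathcal P$ is a fixed effective proof system for $\mathcal L$ with decidable proof checking and a finite rule set, each rule having at most $k$ premises ($k$ constant); $\mathrm{Cn}(\Gamma)$ is the set of formulas derivable in $\mathcal P$ from the finite set $\Gamma$. $\mathbb S_O$ is a fixed ambient set of formulas/semantic states with finite binary encodings $\mathrm{enc}_O$, decidable equality and effectively evaluable predicates. A premise base is a finite effectively listable $B\subseteq\mathbb S_O$, with a canonical computable encoding $\langle B\rangle\in\{0,1\}^*$ (e.g. a length-prefixed list in a fixed order). Depth: $P_O$ assigns to each $s\in\mathbb S_O$ a finite set $P_O(s)\subseteq\mathbb S_O$ computable from $\mathrm{enc}_O(s)$, and backward unfolding along $P_O$ has no infinite chain. Alignment: for $s\in\mathbb S_O\setminus B$, $P_O(s)$ is exactly the set of immediate premises in a fixed normal-form single-step inference of $\mathcal P$ concluding $s$. $\mathrm{Dd}(s\mid B)=0$ if $s\in B$, else $1+\max_{s'\in P_O(s)}\mathrm{Dd}(s'\mid B)$ (with $\max\varnothing=0$). Traces: a derivation trace of $q$ from $B$ is $\pi=((r_1,\vec p_1),\dots,(r_\ell,\vec p_\ell);o)$ with $r_i$ rule identifiers, $\vec p_i$ vectors of indices, $o$ an index, such that the following replay outputs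 $q$: $P_0$ is the list of elements of $B$ in the canonical order; at step $i$ rule $r_i$ is applied to the formulas of the pool $P_{i-1}$ indexed by $\vec p_i$, and its conclusion is appended to give $P_i$; the output is the formula at index $o$ of $P_\ell$. It is valid if each rule application is correct in $\mathcal P$. Length $|\pi|=\ell$ ($\ell=0$ allowed). $N(q\mid B)$ is the minimum length of a valid trace deriving $q$ from $B$. Complexity: $U$ is a fixed universal Turing machine, $K(\cdot\mid\cdot)$ is prefix-free conditional Kolmogorov complexity with respect to $U$, and $q$ is identified with its encoding $\langle q\rangle$. $H_{\mathrm{derive}}(q\mid B)=\mathrm{Dd}(q\mid B)\ln 2$, $H_K(q\mid B)=K(q\mid\langle B\rangle)\ln 2$. Serializability (for a class of instances): for all $(q,B)$ in the class with $q\in\mathrm{Cn}(B)$ and $\mathrm{Dd}(q\mid B)<\infty$, $c_{\min}\mathrm{Dd}(q\mid B)\le N(q\mid B)\le c_{\max}\mathrm{Dd}(q\mid B)$. Richness with parameter $\delta_0>0$: there is $m_0>0$ such that for all $m\ge m_0$, all integers $n$ with $\log m\le n\le\mathrm{poly}(m)$, and all premise bases $B$ with $|B|=m$, $|\{\langle q\rangle:N(q\mid B)=n\}|\ge2^{(1-\delta_0)n\log(m+n)}$.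
   Formalization: The formal statement also requires δ < 1 in (ii) and in the consequences (at δ = 1 the bound is undefined; for δ > 1 its right-hand side is at most 0 while Dd ≥ 1, so it fails), and requires B to be nonempty so that log m is defined. *)

theory Defs
  imports
    Complex_Main
    "HOL-Library.Extended_Nat"
    "HOL-Library.Sublist"
    "HOL-Library.Landau_Symbols"
    "HOL-Computational_Algebra.Polynomial"
begin

section \<open>Turing machines\<close>

text \<open>Deterministic multi-tape machines. A tape is two-way infinite and is indexed relative to the
  head, so the scanned cell is always cell 0 and a move shifts the tape. A machine halts
  when its table has no entry; finiteness of the table bounds states and alphabet.\<close>

datatype sym = Blank | Bit bool | Mark nat
datatype move = Lft | Stay | Rgt

type_synonym tape = "int \<Rightarrow> sym"

record tm =
  tapes :: nat
  table :: "nat \<times> sym list \<Rightarrow> (nat \<times> (sym \<times> move) list) option"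

definition wf_tm :: "tm \<Rightarrow> bool" where
  "wf_tm M \<longleftrightarrow> tapes M \<ge> 1 \<and> finite (dom (table M)) \<and>
     (\<forall>s as s' acts. table M (s, as) = Some (s', acts) \<longrightarrow>
        length as = tapes M \<and> length acts = tapes M)"

fun shift :: "move \<Rightarrow> tape \<Rightarrow> tape" where
  "shift Lft t = (\<lambda>i. t (i - 1))"
| "shift Stay t = t"
| "shift Rgt t = (\<lambda>i. t (i + 1))"

fun act :: "sym \<times> move \<Rightarrow> tape \<Rightarrow> tape" where
  "act (a, mv) t = shift mv (t(0 := a))"

inductive tm_step :: "tm \<Rightarrow> nat \<times> tape list \<Rightarrow> nat \<times> tape list \<Rightarrow> bool" for M where
  "table M (s, map (\<lambda>t. t 0) ts) = Some (s', acts) \<Longrightarrow>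
     tm_step M (s, ts) (s', map2 act acts ts)"

definition inscribe :: "bool list \<Rightarrow> tape" where
  "inscribe w = (\<lambda>i. if 0 \<le> i \<and> i < int (length w) then Bit (w ! nat i) else Blank)"

definition config :: "tm \<Rightarrow> bool list list \<Rightarrow> tape list" where
  "config M ws = map inscribe ws @ replicate (tapes M - length ws) (inscribe [])"

text \<open>Started in state 0 with the inputs on its first tapes, the machine halts in standard
  configuration: the output on the first tape, head at its left end, all other tapes blank.
  A run that halts in any other configuration has no output.\<close>

definition tm_out :: "tm \<Rightarrow> bool list list \<Rightarrow> bool list \<Rightarrow> bool" where
  "tm_out M ws v \<longleftrightarrow>
     (\<exists>s ts. (tm_step M)\<^sup>*\<^sup>* (0, config M ws) (s, ts) \<and>
       table M (s, map (\<lambda>t. t 0) ts) = None \<and> ts = config M [v])"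

definition computable_on :: "bool list set \<Rightarrow> (bool list \<Rightarrow> bool list) \<Rightarrow> bool" where
  "computable_on D f \<longleftrightarrow> (\<exists>M. wf_tm M \<and> (\<forall>w\<in>D. tm_out M [w] (f w)))"

text \<open>Lists of strings are encoded by prefixing each entry with its length in unary.\<close>

definition list_code :: "bool list list \<Rightarrow> bool list" where
  "list_code ws = concat (map (\<lambda>w. replicate (length w) True @ [False] @ w) ws)"


section \<open>Prefix-free conditional Kolmogorov complexity\<close>

definition prefix_machine :: "tm \<Rightarrow> bool" where
  "prefix_machine M \<longleftrightarrow> wf_tm M \<and>
     (\<forall>y p p' x x'. tm_out M [p, y] x \<and> tm_out M [p', y] x' \<and> prefix p p' \<longrightarrow> p = p')"

definition universal :: "tm \<Rightarrow> bool" where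
  "universal U \<longleftrightarrow> prefix_machine U \<and>
     (\<forall>V. prefix_machine V \<longrightarrow>
       (\<exists>w. \<forall>p y x. tm_out U [w @ p, y] x \<longleftrightarrow> tm_out V [p, y] x))"

text \<open>For universal \<open>U\<close> the set of programs is nonempty, since every \<open>x\<close> is the output of some
  prefix machine.\<close>

definition Kcond :: "tm \<Rightarrow> bool list \<Rightarrow> bool list \<Rightarrow> nat" where
  "Kcond U x y = (LEAST l. \<exists>p. length p = l \<and> tm_out U [p, y] x)"


section \<open>Syntax of many-sorted FO(LFP)\<close>

type_synonym sort = nat

record signature =
  sorts :: "sort set"
  fun_type :: "nat \<Rightarrow> (sort list \<times> sort) option"
  rel_type :: "nat \<Rightarrow> sort list option"

datatype trm = Var nat sort | Fn nat "trm list"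

text \<open>\<open>RVar X ss ts\<close> applies the relation variable \<open>X\<close> of type \<open>ss\<close>; \<open>Lfp X xs \<phi> ts\<close> is
  \<open>[lfp X, xs. \<phi>](ts)\<close>, binding the sorted variables \<open>xs\<close> and the relation variable \<open>X\<close> of type
  \<open>map snd xs\<close> in \<open>\<phi>\<close>.\<close>

datatype fml =
    Rel nat "trm list"
  | RVar nat "sort list" "trm list"
  | Eq trm trm
  | Neg fml
  | Conj fml fml
  | Disj fml fml
  | All nat sort fml
  | Ex nat sort fml
  | Lfp nat "(nat \<times> sort) list" fml "trm list"

fun sort_of :: "signature \<Rightarrow> trm \<Rightarrow> sort option" where
  "sort_of \<Sigma> (Var x s) = (if s \<in> sorts \<Sigma> then Some s else None)"
| "sort_of \<Sigma> (Fn f ts) =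
     (case fun_type \<Sigma> f of None \<Rightarrow> None
      | Some (ss, s) \<Rightarrow> if s \<in> sorts \<Sigma> \<and> map (sort_of \<Sigma>) ts = map Some ss then Some s else None)"

fun free_rvars :: "fml \<Rightarrow> (nat \<times> sort list) set" where
  "free_rvars (Rel R ts) = {}"
| "free_rvars (RVar X ss ts) = {(X, ss)}"
| "free_rvars (Eq t u) = {}"
| "free_rvars (Neg \<phi>) = free_rvars \<phi>"
| "free_rvars (Conj \<phi> \<psi>) = free_rvars \<phi> \<union> free_rvars \<psi>"
| "free_rvars (Disj \<phi> \<psi>) = free_rvars \<phi> \<union> free_rvars \<psi>"
| "free_rvars (All x s \<phi>) = free_rvars \<phi>"
| "free_rvars (Ex x s \<phi>) = free_rvars \<phi>"
| "free_rvars (Lfp X xs \<phi> ts) = free_rvars \<phi> - {(X, map snd xs)}"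

text \<open>\<open>occurs_only b X \<phi>\<close>: all free occurrences of \<open>X\<close> in \<open>\<phi>\<close> are positive if \<open>b\<close>, and
  negative otherwise.\<close>

fun occurs_only :: "bool \<Rightarrow> nat \<times> sort list \<Rightarrow> fml \<Rightarrow> bool" where
  "occurs_only b X (Rel R ts) = True"
| "occurs_only b X (RVar Y ss ts) = ((Y, ss) = X \<longrightarrow> b)"
| "occurs_only b X (Eq t u) = True"
| "occurs_only b X (Neg \<phi>) = occurs_only (\<not> b) X \<phi>"
| "occurs_only b X (Conj \<phi> \<psi>) = (occurs_only b X \<phi> \<and> occurs_only b X \<psi>)"
| "occurs_only b X (Disj \<phi> \<psi>) = (occurs_only b X \<phi> \<and> occurs_only b X \<psi>)"
| "occurs_only b X (All x s \<phi>) = occurs_only b X \<phi>"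
| "occurs_only b X (Ex x s \<phi>) = occurs_only b X \<phi>"
| "occurs_only b X (Lfp Y xs \<phi> ts) = ((Y, map snd xs) = X \<or> occurs_only b X \<phi>)"

fun wf_fml :: "signature \<Rightarrow> fml \<Rightarrow> bool" where
  "wf_fml \<Sigma> (Rel R ts) =
     (\<exists>ss. rel_type \<Sigma> R = Some ss \<and> map (sort_of \<Sigma>) ts = map Some ss)"
| "wf_fml \<Sigma> (RVar X ss ts) = (map (sort_of \<Sigma>) ts = map Some ss)"
| "wf_fml \<Sigma> (Eq t u) = (sort_of \<Sigma> t \<noteq> None \<and> sort_of \<Sigma> t = sort_of \<Sigma> u)"
| "wf_fml \<Sigma> (Neg \<phi>) = wf_fml \<Sigma> \<phi>"
| "wf_fml \<Sigma> (Conj \<phi> \<psi>) = (wf_fml \<Sigma> \<phi> \<and> wf_fml \<Sigma> \<psi>)"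
| "wf_fml \<Sigma> (Disj \<phi> \<psi>) = (wf_fml \<Sigma> \<phi> \<and> wf_fml \<Sigma> \<psi>)"
| "wf_fml \<Sigma> (All x s \<phi>) = (s \<in> sorts \<Sigma> \<and> wf_fml \<Sigma> \<phi>)"
| "wf_fml \<Sigma> (Ex x s \<phi>) = (s \<in> sorts \<Sigma> \<and> wf_fml \<Sigma> \<phi>)"
| "wf_fml \<Sigma> (Lfp X xs \<phi> ts) =
     (distinct xs \<and> map (sort_of \<Sigma>) ts = map (\<lambda>x. Some (snd x)) xs \<and>
      wf_fml \<Sigma> \<phi> \<and> occurs_only True (X, map snd xs) \<phi>)"

definition FO_LFP :: "signature \<Rightarrow> fml set" where
  "FO_LFP \<Sigma> = {\<phi>. wf_fml \<Sigma> \<phi> \<and> free_rvars \<phi> = {}}"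


section \<open>Proof systems, the ambient set, and encodings\<close>

text \<open>A trace records only rule identifiers and premise indices and must determine the replayed
  formulas, so a rule is a partial function from premise vectors to its conclusion.\<close>

record calculus =
  rules :: "nat set"
  max_premises :: nat
  conclusion :: "nat \<Rightarrow> fml list \<Rightarrow> fml option"

text \<open>\<open>enc\<close> encodes all formulas of the logic; its restriction to \<open>states\<close> is the encoding of the
  ambient set. \<open>unfold\<close> is the map \<open>P_O\<close>, \<open>normal_form s\<close> the rule and premise vector of the
  fixed normal-form inference concluding \<open>s\<close>, \<open>listing B\<close> the elements of \<open>B\<close> in canonical order,
  and \<open>code B\<close> the canonical encoding of a premise base.\<close>

record ambient =
  states :: "fml set"
  enc :: "fml \<Rightarrow> bool list"
  unfold :: "fml \<Rightarrow> fml set"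
  normal_form :: "fml \<Rightarrow> nat \<times> fml list"
  listing :: "fml set \<Rightarrow> fml list"
  code :: "fml set \<Rightarrow> bool list"

definition premise_base :: "ambient \<Rightarrow> fml set \<Rightarrow> bool" where
  "premise_base A B \<longleftrightarrow> finite B \<and> B \<subseteq> states A"

text \<open>The machine for a rule halts on every list of encoded formulas, returning the encoded
  conclusion behind a flag, or the empty string if the rule does not apply; so correctness of
  an inference step is decidable.\<close>

definition effective_calculus :: "signature \<Rightarrow> ambient \<Rightarrow> calculus \<Rightarrow> bool" where
  "effective_calculus \<Sigma> A P \<longleftrightarrow>
     finite (rules P) \<and>
     (\<forall>r\<in>rules P. \<forall>ps \<phi>. conclusion P r ps = Some \<phi> \<and> set ps \<subseteq> FO_LFP \<Sigma> \<longrightarrow>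
        length ps \<le> max_premises P \<and> \<phi> \<in> FO_LFP \<Sigma>) \<and>
     (\<forall>r\<in>rules P. \<exists>M. wf_tm M \<and>
        (\<forall>ps. set ps \<subseteq> FO_LFP \<Sigma> \<longrightarrow>
          tm_out M [list_code (map (enc A) ps)]
            (case conclusion P r ps of None \<Rightarrow> [] | Some \<phi> \<Rightarrow> True # enc A \<phi>)))"

text \<open>Decidability of equality on the ambient set is subsumed by injectivity of \<open>enc\<close>.\<close>

definition effective_states :: "signature \<Rightarrow> ambient \<Rightarrow> bool" where
  "effective_states \<Sigma> A \<longleftrightarrow>
     states A \<subseteq> FO_LFP \<Sigma> \<and> inj_on (enc A) (FO_LFP \<Sigma>) \<and>
     computable_on UNIV (\<lambda>w. [w \<in> enc A ` states A])"

definition unfolding_rel :: "ambient \<Rightarrow> (fml \<times> fml) set" where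
  "unfolding_rel A = {(s', s). s \<in> states A \<and> s' \<in> unfold A s}"

definition effective_unfolding :: "ambient \<Rightarrow> bool" where
  "effective_unfolding A \<longleftrightarrow>
     (\<forall>s\<in>states A. finite (unfold A s) \<and> unfold A s \<subseteq> states A) \<and>
     (\<exists>M. wf_tm M \<and> (\<forall>s\<in>states A. \<exists>ps. set ps = unfold A s \<and>
        tm_out M [enc A s] (list_code (map (enc A) ps)))) \<and>
     wf (unfolding_rel A)"

text \<open>The canonical encoding is computable from any listing of the base, and the canonical listing
  is computable from it.\<close>

definition effective_bases :: "ambient \<Rightarrow> bool" where
  "effective_bases A \<longleftrightarrow>
     (\<forall>B. premise_base A B \<longrightarrow> set (listing A B) = B \<and> distinct (listing A B)) \<and>
     (\<exists>M. wf_tm M \<and> (\<forall>ss. set ss \<subseteq> states A \<longrightarrow>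
        tm_out M [list_code (map (enc A) ss)] (code A (set ss)))) \<and>
     (\<exists>M. wf_tm M \<and> (\<forall>B. premise_base A B \<longrightarrow>
        tm_out M [code A B] (list_code (map (enc A) (listing A B)))))"

definition aligned :: "calculus \<Rightarrow> ambient \<Rightarrow> fml set \<Rightarrow> bool" where
  "aligned P A B \<longleftrightarrow>
     (\<forall>s\<in>states A - B. \<forall>r ps. normal_form A s = (r, ps) \<longrightarrow>
        r \<in> rules P \<and> conclusion P r ps = Some s \<and> set ps = unfold A s)"


section \<open>Derivability, depth and trace length\<close>

inductive_set Cn :: "calculus \<Rightarrow> fml set \<Rightarrow> fml set" for P \<Gamma> where
  base: "\<phi> \<in> \<Gamma> \<Longrightarrow> \<phi> \<in> Cn P \<Gamma>"
| rule: "r \<in> rules P \<Longrightarrow> \<forall>\<psi>\<in>set ps. \<psi> \<in> Cn P \<Gamma> \<Longrightarrow> conclusion P r ps = Some \<phi> \<Longrightarrow> \<phi> \<in> Cn P \<Gamma>"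

definition Dd :: "ambient \<Rightarrow> fml set \<Rightarrow> fml \<Rightarrow> nat" where
  "Dd A B = wfrec (unfolding_rel A)
     (\<lambda>f s. if s \<in> B then 0 else 1 + Max (insert 0 (f ` unfold A s)))"

lemma Dd_eq:
  assumes "effective_unfolding A" "s \<in> states A"
  shows "Dd A B s = (if s \<in> B then 0 else 1 + Max (insert 0 (Dd A B ` unfold A s)))"
proof -
  have wf: "wf (unfolding_rel A)"
    using assms(1) by (simp add: effective_unfolding_def)
  have "cut (Dd A B) (unfolding_rel A) s ` unfold A s = Dd A B ` unfold A s"
    by (rule image_cong) (use assms(2) in \<open>auto simp: cut_apply unfolding_rel_def\<close>)
  then show ?thesis
    unfolding Dd_def by (subst wfrec[OF wf]) (simp add: Dd_def)
qed

fun replay :: "calculus \<Rightarrow> fml list \<Rightarrow> (nat \<times> nat list) list \<Rightarrow> fml list option" where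
  "replay P pool [] = Some pool"
| "replay P pool ((r, is) # steps) =
     (if r \<in> rules P \<and> (\<forall>i\<in>set is. i < length pool)
      then (case conclusion P r (map ((!) pool) is) of
              None \<Rightarrow> None
            | Some \<phi> \<Rightarrow> replay P (pool @ [\<phi>]) steps)
      else None)"

text \<open>Indices are 0-based.\<close>

definition derives ::
  "calculus \<Rightarrow> ambient \<Rightarrow> fml set \<Rightarrow> (nat \<times> nat list) list \<times> nat \<Rightarrow> fml \<Rightarrow> bool" where
  "derives P A B tr q \<longleftrightarrow>
     (\<exists>pool. replay P (listing A B) (fst tr) = Some pool \<and>
        snd tr < length pool \<and> pool ! snd tr = q)"

text \<open>The value is \<open>\<infinity>\<close> if there is no valid trace.\<close>

definition Nsteps :: "calculus \<Rightarrow> ambient \<Rightarrow> fml set \<Rightarrow> fml \<Rightarrow> enat" where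
  "Nsteps P A B q = (INF tr\<in>{tr. derives P A B tr q}. enat (length (fst tr)))"


section \<open>Instances, serializability, richness, genericity\<close>

definition Kq :: "tm \<Rightarrow> ambient \<Rightarrow> fml set \<Rightarrow> fml \<Rightarrow> real" where
  "Kq U A B q = real (Kcond U (enc A q) (code A B))"

definition H_derive :: "ambient \<Rightarrow> fml set \<Rightarrow> fml \<Rightarrow> real" where
  "H_derive A B q = real (Dd A B q) * ln 2"

definition H_K :: "tm \<Rightarrow> ambient \<Rightarrow> fml set \<Rightarrow> fml \<Rightarrow> real" where
  "H_K U A B q = Kq U A B q * ln 2"

definition instance_class :: "calculus \<Rightarrow> ambient \<Rightarrow> (fml \<times> fml set) set \<Rightarrow> bool" where
  "instance_class P A C \<longleftrightarrow>
     (\<forall>(q, B)\<in>C. premise_base A B \<and> q \<in> states A \<and> aligned P A B)"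

text \<open>\<open>Dd\<close> takes values in \<open>nat\<close>, so the proviso that the depth is finite always holds.\<close>

definition serializable ::
  "calculus \<Rightarrow> ambient \<Rightarrow> real \<Rightarrow> real \<Rightarrow> (fml \<times> fml set) set \<Rightarrow> bool" where
  "serializable P A cmin cmax C \<longleftrightarrow>
     (\<forall>(q, B)\<in>C. q \<in> Cn P B \<longrightarrow>
        (\<exists>n. Nsteps P A B q = enat n \<and>
           cmin * real (Dd A B q) \<le> real n \<and> real n \<le> cmax * real (Dd A B q)))"

definition rich :: "calculus \<Rightarrow> ambient \<Rightarrow> real poly \<Rightarrow> real \<Rightarrow> bool" where
  "rich P A pb \<delta>\<^sub>0 \<longleftrightarrow>
     (\<exists>m\<^sub>0>0. \<forall>m\<ge>m\<^sub>0. \<forall>n::nat. log 2 (real m) \<le> real n \<and> real n \<le> poly pb (real m) \<longrightarrow>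
        (\<forall>B. premise_base A B \<and> card B = m \<longrightarrow>
           real (card {enc A q |q. q \<in> states A \<and> Nsteps P A B q = enat n})
             \<ge> 2 powr ((1 - \<delta>\<^sub>0) * real n * log 2 (real m + real n))))"

text \<open>The base is nonempty because \<open>log m\<close> is only meaningful for \<open>m \<ge> 1\<close>.\<close>

definition admissible ::
  "calculus \<Rightarrow> ambient \<Rightarrow> real poly \<Rightarrow> (fml \<times> fml set) set \<Rightarrow> (fml \<times> fml set) set" where
  "admissible P A pb C =
     {(q, B) \<in> C. B \<noteq> {} \<and> q \<in> Cn P B \<and> Dd A B q \<ge> 1 \<and>
        log 2 (real (card B)) \<le> real (Dd A B q) \<and>
        real (Dd A B q) \<le> poly pb (real (card B))}"

definition generic ::
  "calculus \<Rightarrow> ambient \<Rightarrow> tm \<Rightarrow> real \<Rightarrow> (fml \<times> fml set) set" where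
  "generic P A U \<delta> =
     {(q, B). \<exists>n. Nsteps P A B q = enat n \<and>
        Kq U A B q \<ge> (1 - \<delta>) * real n * log 2 (real (card B) + real n)}"

definition log_size :: "ambient \<Rightarrow> fml set \<Rightarrow> fml \<Rightarrow> real" where
  "log_size A B q = log 2 (real (card B) + real (Dd A B q))"

end

theory Submission
  imports Defs
begin

text \<open>
  A derivation trace of length \<open>l\<close> over a base of size \<open>m\<close> is determined by \<open>O(l)\<close> pool indices below
  \<open>m + l\<close> and \<open>O(l)\<close> rule names from a finite list, hence by \<open>O(l log (m + l))\<close> bits, and a fixed
  machine replays it from the code of the base; serializability replaces \<open>l\<close> by the depth. For
  generic queries the lower bound is the genericity assumption combined with serializability.

  The replaying machine rests on one observation: a tape in standard configuration is a stack of
  bits with its top under the head. So a halting run of a machine maps stacks to stacks, and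
  the given machines can be called as subroutines of a stack program. The program is made
  prefix-free by doubling its bits; an ill-formed input is rejected by halting with a nonblank error
  tape, which is not a standard configuration.
\<close>

section \<open>Stack programs and their compilation to Turing machines\<close>

text \<open>The universality of \<open>U\<close> applies only to an actual transition table, so the
  replaying machine has to be built; the program language keeps that construction compositional.
  \<open>exec\<close> relates start and end of terminating runs only, and compilation is proved in
  this direction only. Two facts about the interpreter then suffice: the code of a trace leads to
  its output, and an ill-formed program has no output. The second, a negative statement, is also
  reduced to a terminating run, one that ends in a non-standard configuration, because runs are
  deterministic. Hence decoding must terminate on every input, while a well-formed program may later
  diverge or get stuck without harm to prefix-freeness. The logarithm arises from naming pool
  positions in binary, by doubling and incrementing a counter. The counter itself may be unary,
  since only the length of the program counts and not its running time. All costs that do not grow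
  with the trace are absorbed by \<open>m + l \<ge> 2\<close>, which makes the logarithm at least
  1.\<close>

datatype prog =
    Push nat bool
  | Pop nat
  | Call tm nat
  | Seq prog prog (infixr ";;" 65)
  | Cond nat "bool option \<Rightarrow> bool" prog prog
  | While nat "bool option \<Rightarrow> bool" prog

definition top_bit :: "bool list \<Rightarrow> bool option" where
  "top_bit w = (case w of [] \<Rightarrow> None | b # _ \<Rightarrow> Some b)"

lemma top_bit_simps [simp]: "top_bit [] = None" "top_bit (b # w) = Some b"
  by (simp_all add: top_bit_def)

text \<open>\<open>tm_out\<close> starts and ends with blank tapes beside the first one, so
  \<open>Call\<close> asks for empty stacks there and leaves them empty. A call without output has
  no rule: \<open>exec\<close> is silent about it, as about divergence.\<close>

inductive exec :: "prog \<Rightarrow> (nat \<Rightarrow> bool list) \<Rightarrow> (nat \<Rightarrow> bool list) \<Rightarrow> bool" where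
  exec_Push: "exec (Push i b) s (s(i := b # s i))"
| exec_Pop: "exec (Pop i) s (s(i := tl (s i)))"
| exec_Call: "tm_out M [s i] v \<Longrightarrow> \<forall>j. i < j \<and> j < i + tapes M \<longrightarrow> s j = [] \<Longrightarrow>
    exec (Call M i) s (s(i := v))"
| exec_Seq: "exec p s t \<Longrightarrow> exec r t u \<Longrightarrow> exec (p ;; r) s u"
| exec_Cond_True: "c (top_bit (s i)) \<Longrightarrow> exec p s t \<Longrightarrow> exec (Cond i c p r) s t"
| exec_Cond_False: "\<not> c (top_bit (s i)) \<Longrightarrow> exec r s t \<Longrightarrow> exec (Cond i c p r) s t"
| exec_While_False: "\<not> c (top_bit (s i)) \<Longrightarrow> exec (While i c p) s s"
| exec_While_True: "c (top_bit (s i)) \<Longrightarrow> exec p s t \<Longrightarrow> exec (While i c p) t u \<Longrightarrow>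
    exec (While i c p) s u"

fun wf_prog :: "nat \<Rightarrow> prog \<Rightarrow> bool" where
  "wf_prog T (Push i b) = (i < T)"
| "wf_prog T (Pop i) = (i < T)"
| "wf_prog T (Call M i) = (wf_tm M \<and> i + tapes M \<le> T)"
| "wf_prog T (p ;; r) = (wf_prog T p \<and> wf_prog T r)"
| "wf_prog T (Cond i c p r) = (i < T \<and> wf_prog T p \<and> wf_prog T r)"
| "wf_prog T (While i c p) = (i < T \<and> wf_prog T p)"

section \<open>Tapes as stacks of bits\<close>

definition bits :: "sym set" where
  "bits = {Blank, Bit True, Bit False}"

text \<open>\<open>Mark\<close> makes the alphabet infinite while a table must be finite. The
  transitions that the compiler adds itself are therefore confined to heads on blanks or bits, which
  is all that stacks ever show.\<close>

definition scans :: "nat \<Rightarrow> sym list set" where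
  "scans T = {as. set as \<subseteq> bits \<and> length as = T}"

definition stacks :: "nat \<Rightarrow> (nat \<Rightarrow> bool list) \<Rightarrow> tape list" where
  "stacks T s = map (\<lambda>i. inscribe (s i)) [0..<T]"

definition scan :: "nat \<Rightarrow> (nat \<Rightarrow> bool list) \<Rightarrow> sym list" where
  "scan T s = map (\<lambda>t. t 0) (stacks T s)"

fun bit_of :: "sym \<Rightarrow> bool option" where
  "bit_of (Bit b) = Some b"
| "bit_of _ = None"

definition keep :: "sym list \<Rightarrow> (sym \<times> move) list" where
  "keep as = map (\<lambda>a. (a, Stay)) as"

lemma finite_scans: "finite (scans T)"
  unfolding scans_def bits_def by (rule finite_lists_length_eq) simp

lemma inscribe_0: "inscribe w 0 = (case w of [] \<Rightarrow> Blank | b # _ \<Rightarrow> Bit b)"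
  by (cases w) (auto simp: inscribe_def)

lemma inscribe_0_bits: "inscribe w 0 \<in> bits"
  by (auto simp: inscribe_0 bits_def split: list.split)

lemma inscribe_eq_Nil_iff: "inscribe w = inscribe [] \<longleftrightarrow> w = []"
proof
  assume "inscribe w = inscribe []"
  then have "inscribe w 0 = inscribe [] 0" by simp
  then show "w = []" by (cases w) (auto simp: inscribe_0)
qed simp

lemma bit_of_inscribe: "bit_of (inscribe w 0) = top_bit w"
  by (auto simp: inscribe_0 split: list.split)

lemma length_stacks [simp]: "length (stacks T s) = T"
  by (simp add: stacks_def)

lemma nth_stacks [simp]: "i < T \<Longrightarrow> stacks T s ! i = inscribe (s i)"
  by (simp add: stacks_def)

lemma nth_scan: "i < T \<Longrightarrow> scan T s ! i = inscribe (s i) 0"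
  by (simp add: scan_def)

lemma scan_scans [simp]: "scan T s \<in> scans T"
  using inscribe_0_bits by (auto simp: scan_def scans_def stacks_def)

lemma length_keep [simp]: "length (keep as) = length as"
  by (simp add: keep_def)

lemma act_keep [simp]: "map2 act (keep (map (\<lambda>t. t 0) ts)) ts = ts"
  by (induction ts) (auto simp: keep_def)

lemma act_keep_update:
  "i < length ts \<Longrightarrow>
    map2 act ((keep (map (\<lambda>t. t 0) ts))[i := (x, mv)]) ts = ts[i := act (x, mv) (ts ! i)]"
proof (induction ts arbitrary: i)
  case (Cons t ts)
  have "map2 act (keep (map (\<lambda>t. t 0) ts)) ts = ts" by simp
  then show ?case using Cons by (cases i) (auto simp: keep_def)
qed simp

lemma stacks_update: "i < T \<Longrightarrow> (stacks T s)[i := inscribe w] = stacks T (s(i := w))"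
  by (rule nth_equalityI) (auto simp: nth_list_update)

section \<open>Runs of deterministic machines\<close>

lemma tm_stepI:
  "table M (q, map (\<lambda>t. t 0) ts) = Some (q', acts) \<Longrightarrow> ts' = map2 act acts ts \<Longrightarrow>
    tm_step M (q, ts) (q', ts')"
  by (auto intro: tm_step.intros)

lemma tm_step_deterministic: "tm_step M c d \<Longrightarrow> tm_step M c e \<Longrightarrow> d = e"
  by (auto elim!: tm_step.cases)

definition halted :: "tm \<Rightarrow> nat \<times> tape list \<Rightarrow> bool" where
  "halted M c \<longleftrightarrow> table M (fst c, map (\<lambda>t. t 0) (snd c)) = None"

lemma halted_no_step: "halted M c \<Longrightarrow> \<not> tm_step M c d"
  by (auto simp: halted_def elim!: tm_step.cases)

text \<open>Determinism makes one run an initial segment of the other, and a halted configuration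
  cannot be continued. One known terminating run thereby excludes every other result.\<close>

lemma halting_unique:
  assumes "(tm_step M)\<^sup>*\<^sup>* c d" "halted M d" "(tm_step M)\<^sup>*\<^sup>* c e" "halted M e"
  shows "d = e"
  using assms
proof (induction rule: converse_rtranclp_induct)
  case base
  then show ?case by (metis converse_rtranclpE halted_no_step)
next
  case (step c c')
  from step.prems(2) show ?case
  proof (cases rule: converse_rtranclpE)
    case base
    then show ?thesis using step.hyps(1) step.prems(3) halted_no_step by blast
  next
    case (step y)
    then show ?thesis
      using step.IH step.prems step.hyps tm_step_deterministic by metis
  qed
qed

definition halts_at :: "tm \<Rightarrow> (nat \<Rightarrow> bool list) \<Rightarrow> (nat \<Rightarrow> bool list) \<Rightarrow> bool" where
  "halts_at M s t \<longleftrightarrow>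
     (\<exists>q. (tm_step M)\<^sup>*\<^sup>* (0, stacks (tapes M) s) (q, stacks (tapes M) t) \<and>
       table M (q, scan (tapes M) t) = None)"

text \<open>Only one direction is demanded: what the program does, the machine does. Where an output
  has to be excluded, \<open>halting_unique\<close> takes the place of the converse.\<close>

definition implements :: "nat \<Rightarrow> tm \<Rightarrow> prog \<Rightarrow> bool" where
  "implements T M p \<longleftrightarrow> wf_tm M \<and> tapes M = T \<and> (\<forall>s t. exec p s t \<longrightarrow> halts_at M s t)"

text \<open>A finite superset of the states in which a run from state 0 can halt. Jumps out of a
  halted component must be tabulated for all of them, and \<open>nat\<close> would be too
  large.\<close>

definition control :: "tm \<Rightarrow> nat set" where
  "control M = insert 0 (fst ` dom (table M) \<union> fst ` ran (table M))"

lemma finite_control: "wf_tm M \<Longrightarrow> finite (control M)"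
  by (auto simp: control_def wf_tm_def intro: finite_ran)

lemma control_reachable:
  "(tm_step M)\<^sup>*\<^sup>* c d \<Longrightarrow> fst c \<in> control M \<Longrightarrow> fst d \<in> control M"
  by (induction rule: rtranclp_induct)
    (force elim!: tm_step.cases simp: control_def ran_def)+

text \<open>The target may have further entries, namely the glue between components, so this
  transports runs but not halting; each construction treats halting separately.\<close>

lemma embed_run:
  assumes "(tm_step M)\<^sup>*\<^sup>* (q, ts) (q', ts')"
    and "\<And>q as q' acts. table M (q, as) = Some (q', acts) \<Longrightarrow> table N (f q, as) = Some (f q', acts)"
  shows "(tm_step N)\<^sup>*\<^sup>* (f q, ts) (f q', ts')"
  using assms(1)
proof (induction "(q', ts')" arbitrary: q' ts' rule: rtranclp_induct)
  case (step c)
  obtain q1 ts1 where c: "c = (q1, ts1)" by (cases c)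
  then have "(tm_step N)\<^sup>*\<^sup>* (f q, ts) (f q1, ts1)" using step by blast
  moreover have "tm_step N (f q1, ts1) (f q', ts')"
    using step.hyps(2) c by (auto elim!: tm_step.cases intro!: tm_stepI dest!: assms(2))
  ultimately show ?case by auto
qed simp

lemma jump_step:
  "table M (q, scan T s) = Some (q', keep (scan T s)) \<Longrightarrow>
    tm_step M (q, stacks T s) (q', stacks T s)"
  by (rule tm_stepI) (auto simp: scan_def)

section \<open>Machines for the program constructs\<close>

lemma wf_tmI:
  assumes "tapes M \<ge> 1" "finite (dom (table M))"
    and "\<And>q as q' acts. table M (q, as) = Some (q', acts) \<Longrightarrow>
      length as = tapes M \<and> length acts = tapes M"
  shows "wf_tm M"
  using assms unfolding wf_tm_def by blast

lemma wf_tm_lengths: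
  "wf_tm M \<Longrightarrow> table M (q, as) = Some (q', acts) \<Longrightarrow>
    length as = tapes M \<and> length acts = tapes M"
  unfolding wf_tm_def by blast

text \<open>\<open>act\<close> writes before it moves. Pushing must first move left onto the blank
  cell and then write, hence two steps; popping erases and moves right, and its second step
  idles.\<close>

definition two_step :: "nat \<Rightarrow> nat \<Rightarrow> (sym \<Rightarrow> sym \<times> move) \<Rightarrow> (sym \<Rightarrow> sym \<times> move) \<Rightarrow> tm" where
  "two_step T i f g = \<lparr>tapes = T, table = (\<lambda>(q, as).
     if as \<in> scans T \<and> q = 0 then Some (1, (keep as)[i := f (as ! i)])
     else if as \<in> scans T \<and> q = 1 then Some (2, (keep as)[i := g (as ! i)]) else None)\<rparr>"

lemma wf_two_step: "T \<ge> 1 \<Longrightarrow> wf_tm (two_step T i f g)"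
proof (rule wf_tmI)
  have "dom (table (two_step T i f g)) \<subseteq> {0, 1} \<times> scans T"
    by (auto simp: two_step_def split: if_splits)
  then show "finite (dom (table (two_step T i f g)))"
    by (rule finite_subset) (simp add: finite_scans)
qed (auto simp: two_step_def scans_def split: if_splits)

lemma two_step_halts:
  assumes "i < T"
    and t': "t' = act (f (inscribe (s i) 0)) (inscribe (s i))" and "t' 0 \<in> bits"
    and "act (g (t' 0)) t' = inscribe w"
  shows "halts_at (two_step T i f g) s (s(i := w))"
proof -
  let ?M = "two_step T i f g"
  let ?ts = "(stacks T s)[i := t']"
  have "tm_step ?M (0, stacks T s) (1, ?ts)"
  proof (rule tm_stepI)
    show "table ?M (0, map (\<lambda>t. t 0) (stacks T s)) =
        Some (1, (keep (scan T s))[i := f (inscribe (s i) 0)])"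
      using assms(1) by (simp add: two_step_def scan_def[symmetric] nth_scan)
    show "?ts = map2 act ((keep (scan T s))[i := f (inscribe (s i) 0)]) (stacks T s)"
      using assms(1) t' act_keep_update[of i "stacks T s"]
      by (cases "f (inscribe (s i) 0)") (simp add: scan_def)
  qed
  moreover have "tm_step ?M (1, ?ts) (2, stacks T (s(i := w)))"
  proof (rule tm_stepI)
    have "set (map (\<lambda>t. t 0) ?ts) \<subseteq> bits"
    proof
      fix a assume "a \<in> set (map (\<lambda>t. t 0) ?ts)"
      then obtain t where "t \<in> set ?ts" "a = t 0" by auto
      moreover have "set ?ts \<subseteq> insert t' (set (stacks T s))"
        by (rule set_update_subset_insert)
      ultimately show "a \<in> bits"
        using assms(3) inscribe_0_bits by (auto simp: stacks_def)
    qed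
    then have "map (\<lambda>t. t 0) ?ts \<in> scans T" by (simp add: scans_def)
    then show "table ?M (1, map (\<lambda>t. t 0) ?ts) =
        Some (2, (keep (map (\<lambda>t. t 0) ?ts))[i := g (t' 0)])"
      using assms(1) by (simp add: two_step_def)
    show "stacks T (s(i := w)) = map2 act ((keep (map (\<lambda>t. t 0) ?ts))[i := g (t' 0)]) ?ts"
      using assms(1,4) act_keep_update[of i ?ts]
      by (cases "g (t' 0)") (simp add: stacks_update)
  qed
  ultimately have "(tm_step ?M)\<^sup>*\<^sup>* (0, stacks T s) (2, stacks T (s(i := w)))" by simp
  moreover have "table ?M (2, scan T (s(i := w))) = None" by (simp add: two_step_def)
  moreover have "tapes ?M = T" by (simp add: two_step_def)
  ultimately show ?thesis unfolding halts_at_def by metis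
qed

inductive_cases exec_PushE: "exec (Push i b) s t"
inductive_cases exec_PopE: "exec (Pop i) s t"
inductive_cases exec_CallE: "exec (Call M i) s t"
inductive_cases exec_SeqE: "exec (p ;; r) s t"
inductive_cases exec_CondE: "exec (Cond i c p r) s t"

lemma implements_Push:
  assumes "i < T"
  shows "implements T (two_step T i (\<lambda>a. (a, Lft)) (\<lambda>_. (Bit b, Stay))) (Push i b)"
proof -
  let ?M = "two_step T i (\<lambda>a. (a, Lft)) (\<lambda>_. (Bit b, Stay))"
  have "halts_at ?M s (s(i := b # s i))" for s
  proof (rule two_step_halts[OF assms refl])
    show "act (inscribe (s i) 0, Lft) (inscribe (s i)) 0 \<in> bits"
      by (simp add: inscribe_def bits_def)
    show "act (Bit b, Stay) (act (inscribe (s i) 0, Lft) (inscribe (s i))) = inscribe (b # s i)"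
      by (rule ext) (auto simp: inscribe_def nth_Cons' nat_diff_distrib)
  qed
  then show ?thesis
    using assms by (auto simp: implements_def elim!: exec_PushE intro!: wf_two_step)
      (simp add: two_step_def)
qed

lemma implements_Pop:
  assumes "i < T"
  shows "implements T (two_step T i (\<lambda>_. (Blank, Rgt)) (\<lambda>a. (a, Stay))) (Pop i)"
proof -
  let ?M = "two_step T i (\<lambda>_. (Blank, Rgt)) (\<lambda>a. (a, Stay))"
  have "halts_at ?M s (s(i := tl (s i)))" for s
  proof (rule two_step_halts[OF assms refl])
    have eq: "act (Blank, Rgt) (inscribe (s i)) = inscribe (tl (s i))"
      by (rule ext) (auto simp: inscribe_def nth_tl nat_add_distrib)
    show "act (Blank, Rgt) (inscribe (s i)) 0 \<in> bits"
      unfolding eq by (rule inscribe_0_bits)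
    show "act (act (Blank, Rgt) (inscribe (s i)) 0, Stay) (act (Blank, Rgt) (inscribe (s i)))
        = inscribe (tl (s i))"
      unfolding eq by simp
  qed
  then show ?thesis
    using assms by (auto simp: implements_def elim!: exec_PopE intro!: wf_two_step)
      (simp add: two_step_def)
qed

text \<open>Even states run \<open>M\<close>, odd states run \<open>N\<close>. A missing entry of
  \<open>M\<close> becomes a jump to state 1, the start state of \<open>N\<close>.\<close>

definition seq_tm :: "nat \<Rightarrow> tm \<Rightarrow> tm \<Rightarrow> tm" where
  "seq_tm T M N = \<lparr>tapes = T, table = (\<lambda>(x, as).
     if even x then
       (case table M (x div 2, as) of
          Some (q, acts) \<Rightarrow> Some (2 * q, acts)
        | None \<Rightarrow> if x div 2 \<in> control M \<and> as \<in> scans T then Some (1, keep as) else None)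
     else map_option (\<lambda>(q, acts). (2 * q + 1, acts)) (table N (x div 2, as)))\<rparr>"

lemma wf_seq_tm:
  assumes "wf_tm M" "wf_tm N" "tapes M = T" "tapes N = T"
  shows "wf_tm (seq_tm T M N)"
proof (rule wf_tmI)
  have "dom (table (seq_tm T M N)) \<subseteq>
      (\<lambda>(q, as). (2 * q, as)) ` (dom (table M) \<union> control M \<times> scans T) \<union>
      (\<lambda>(q, as). (2 * q + 1, as)) ` dom (table N)" (is "_ \<subseteq> ?D")
  proof
    fix z assume "z \<in> dom (table (seq_tm T M N))"
    moreover obtain x as where z: "z = (x, as)" by (cases z)
    ultimately have nz: "table (seq_tm T M N) (x, as) \<noteq> None" by auto
    show "z \<in> ?D"
    proof (cases "even x")
      case True
      then have "(x div 2, as) \<in> dom (table M) \<union> control M \<times> scans T"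
        using nz by (auto simp: seq_tm_def split: option.splits if_splits)
      moreover have "z = (\<lambda>(q, as). (2 * q, as)) (x div 2, as)" using True z by simp
      ultimately show ?thesis by blast
    next
      case False
      then have "(x div 2, as) \<in> dom (table N)"
        using nz by (auto simp: seq_tm_def)
      moreover have "z = (\<lambda>(q, as). (2 * q + 1, as)) (x div 2, as)" using False z by simp
      ultimately show ?thesis by blast
    qed
  qed
  moreover have "finite ?D"
    using assms finite_control finite_scans by (auto simp: wf_tm_def)
  ultimately show "finite (dom (table (seq_tm T M N)))" by (rule finite_subset)
next
  fix x as q acts
  assume *: "table (seq_tm T M N) (x, as) = Some (q, acts)"
  show "length as = tapes (seq_tm T M N) \<and> length acts = tapes (seq_tm T M N)"
  proof (cases "even x")
    case True
    then show ?thesis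
      using * assms wf_tm_lengths[OF assms(1), of "x div 2" as]
      by (auto simp: seq_tm_def scans_def split: option.splits if_splits)
  next
    case False
    then show ?thesis
      using * assms wf_tm_lengths[OF assms(2), of "x div 2" as] by (auto simp: seq_tm_def)
  qed
qed (use assms in \<open>simp add: seq_tm_def wf_tm_def\<close>)

lemma implements_Seq:
  assumes M: "implements T M p" and N: "implements T N r"
  shows "implements T (seq_tm T M N) (p ;; r)"
proof -
  let ?S = "seq_tm T M N"
  have T: "tapes M = T" "tapes N = T" "tapes ?S = T"
    using assms by (auto simp: implements_def seq_tm_def)
  have "halts_at ?S s u" if p: "exec p s t" and r: "exec r t u" for s t u
  proof -
    obtain q where q: "(tm_step M)\<^sup>*\<^sup>* (0, stacks T s) (q, stacks T t)"
      "table M (q, scan T t) = None"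
      using M p T unfolding implements_def halts_at_def by metis
    obtain q' where q': "(tm_step N)\<^sup>*\<^sup>* (0, stacks T t) (q', stacks T u)"
      "table N (q', scan T u) = None"
      using N r T unfolding implements_def halts_at_def by metis
    have "(tm_step ?S)\<^sup>*\<^sup>* (0, stacks T s) (2 * q, stacks T t)"
      using embed_run[OF q(1), of ?S "\<lambda>q. 2 * q"] by (simp add: seq_tm_def)
    moreover have "q \<in> control M"
      using control_reachable[OF q(1)] by (simp add: control_def)
    then have "tm_step ?S (2 * q, stacks T t) (1, stacks T t)"
      using q(2) by (intro jump_step) (simp add: seq_tm_def)
    moreover have "(tm_step ?S)\<^sup>*\<^sup>* (1, stacks T t) (2 * q' + 1, stacks T u)"
      using embed_run[OF q'(1), of ?S "\<lambda>q. 2 * q + 1"] by (simp add: seq_tm_def)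
    ultimately have "(tm_step ?S)\<^sup>*\<^sup>* (0, stacks T s) (2 * q' + 1, stacks T u)"
      by (meson rtranclp.rtrancl_into_rtrancl rtranclp_trans)
    then show ?thesis
      using q'(2) unfolding halts_at_def T(3) by (intro exI[of _ "2 * q' + 1"]) (simp add: seq_tm_def)
  qed
  then show ?thesis
    using assms T wf_seq_tm by (auto simp: implements_def elim!: exec_SeqE)
qed

definition cond_tm :: "nat \<Rightarrow> nat \<Rightarrow> (bool option \<Rightarrow> bool) \<Rightarrow> tm \<Rightarrow> tm \<Rightarrow> tm" where
  "cond_tm T i c M N = \<lparr>tapes = T, table = (\<lambda>(x, as).
     if x = 0 then
       (if as \<in> scans T then Some (if c (bit_of (as ! i)) then 1 else 2, keep as) else None)
     else if odd x then map_option (\<lambda>(q, acts). (2 * q + 1, acts)) (table M (x div 2, as))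
     else map_option (\<lambda>(q, acts). (2 * q + 2, acts)) (table N (x div 2 - 1, as)))\<rparr>"

lemma wf_cond_tm:
  assumes "wf_tm M" "wf_tm N" "tapes M = T" "tapes N = T"
  shows "wf_tm (cond_tm T i c M N)"
proof (rule wf_tmI)
  have "dom (table (cond_tm T i c M N)) \<subseteq>
      {0} \<times> scans T \<union> (\<lambda>(q, as). (2 * q + 1, as)) ` dom (table M) \<union>
      (\<lambda>(q, as). (2 * q + 2, as)) ` dom (table N)" (is "_ \<subseteq> ?D")
  proof
    fix z assume "z \<in> dom (table (cond_tm T i c M N))"
    moreover obtain x as where z: "z = (x, as)" by (cases z)
    ultimately have nz: "table (cond_tm T i c M N) (x, as) \<noteq> None" by auto
    consider "x = 0" | "odd x" | "even x" "x > 0" by auto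
    then show "z \<in> ?D"
    proof cases
      case 1
      then show ?thesis using nz z by (auto simp: cond_tm_def split: if_splits)
    next
      case 2
      then have "(x div 2, as) \<in> dom (table M)"
        using nz by (auto simp: cond_tm_def split: if_splits)
      moreover have "z = (\<lambda>(q, as). (2 * q + 1, as)) (x div 2, as)" using 2 z by simp
      ultimately show ?thesis by blast
    next
      case 3
      then have "(x div 2 - 1, as) \<in> dom (table N)"
        using nz by (auto simp: cond_tm_def)
      moreover have "z = (\<lambda>(q, as). (2 * q + 2, as)) (x div 2 - 1, as)" using 3 z by auto
      ultimately show ?thesis by blast
    qed
  qed
  moreover have "finite ?D"
    using assms finite_scans by (auto simp: wf_tm_def)
  ultimately show "finite (dom (table (cond_tm T i c M N)))" by (rule finite_subset)
next
  fix x as q acts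
  assume *: "table (cond_tm T i c M N) (x, as) = Some (q, acts)"
  show "length as = tapes (cond_tm T i c M N) \<and> length acts = tapes (cond_tm T i c M N)"
    using * assms wf_tm_lengths[OF assms(1), of "x div 2" as]
      wf_tm_lengths[OF assms(2), of "x div 2 - 1" as]
    by (auto simp: cond_tm_def scans_def split: if_splits)
qed (use assms in \<open>simp add: cond_tm_def wf_tm_def\<close>)

lemma implements_Cond:
  assumes M: "implements T M p" and N: "implements T N r" and i: "i < T"
  shows "implements T (cond_tm T i c M N) (Cond i c p r)"
proof -
  let ?S = "cond_tm T i c M N"
  have T: "tapes M = T" "tapes N = T" "tapes ?S = T"
    using assms by (auto simp: implements_def cond_tm_def)
  have top: "bit_of (scan T s ! i) = top_bit (s i)" for s
    using i by (simp add: nth_scan bit_of_inscribe)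
  have "halts_at ?S s t" if p: "exec p s t" and c: "c (top_bit (s i))" for s t
  proof -
    obtain q where q: "(tm_step M)\<^sup>*\<^sup>* (0, stacks T s) (q, stacks T t)"
      "table M (q, scan T t) = None"
      using M p T unfolding implements_def halts_at_def by metis
    have "tm_step ?S (0, stacks T s) (2 * 0 + 1, stacks T s)"
      using c by (intro jump_step) (simp add: cond_tm_def top)
    also have "(tm_step ?S)\<^sup>*\<^sup>* (2 * 0 + 1, stacks T s) (2 * q + 1, stacks T t)"
      by (rule embed_run[OF q(1), where f = "\<lambda>q. 2 * q + 1"]) (simp add: cond_tm_def)
    finally have "(tm_step ?S)\<^sup>*\<^sup>* (0, stacks T s) (2 * q + 1, stacks T t)" .
    moreover have "table ?S (2 * q + 1, scan T t) = None"
      using q(2) by (simp add: cond_tm_def)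
    ultimately show ?thesis unfolding halts_at_def T(3) by blast
  qed
  moreover have "halts_at ?S s t" if r: "exec r s t" and c: "\<not> c (top_bit (s i))" for s t
  proof -
    obtain q where q: "(tm_step N)\<^sup>*\<^sup>* (0, stacks T s) (q, stacks T t)"
      "table N (q, scan T t) = None"
      using N r T unfolding implements_def halts_at_def by metis
    have "tm_step ?S (0, stacks T s) (2 * 0 + 2, stacks T s)"
      using c by (intro jump_step) (simp add: cond_tm_def top)
    also have "(tm_step ?S)\<^sup>*\<^sup>* (2 * 0 + 2, stacks T s) (2 * q + 2, stacks T t)"
      by (rule embed_run[OF q(1), where f = "\<lambda>q. 2 * q + 2"]) (simp add: cond_tm_def)
    finally have "(tm_step ?S)\<^sup>*\<^sup>* (0, stacks T s) (2 * q + 2, stacks T t)" .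
    moreover have "table ?S (2 * q + 2, scan T t) = None"
      using q(2) by (simp add: cond_tm_def)
    ultimately show ?thesis unfolding halts_at_def T(3) by blast
  qed
  ultimately show ?thesis
    using assms T wf_cond_tm by (auto simp: implements_def elim!: exec_CondE)
qed

text \<open>State 0 is both the test and the exit: when the test fails there is no entry and the
  machine halts. The body runs in the successor states and jumps back to 0 where it would
  halt.\<close>

definition while_tm :: "nat \<Rightarrow> nat \<Rightarrow> (bool option \<Rightarrow> bool) \<Rightarrow> tm \<Rightarrow> tm" where
  "while_tm T i c M = \<lparr>tapes = T, table = (\<lambda>(x, as).
     case x of
       0 \<Rightarrow> if as \<in> scans T \<and> c (bit_of (as ! i)) then Some (1, keep as) else None
     | Suc q \<Rightarrow>
         (case table M (q, as) of
            Some (q', acts) \<Rightarrow> Some (Suc q', acts)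
          | None \<Rightarrow> if q \<in> control M \<and> as \<in> scans T then Some (0, keep as) else None))\<rparr>"

lemma wf_while_tm:
  assumes "wf_tm M" "tapes M = T"
  shows "wf_tm (while_tm T i c M)"
proof (rule wf_tmI)
  have "dom (table (while_tm T i c M)) \<subseteq>
      {0} \<times> scans T \<union> (\<lambda>(q, as). (Suc q, as)) ` (dom (table M) \<union> control M \<times> scans T)"
    (is "_ \<subseteq> ?D")
  proof
    fix z assume "z \<in> dom (table (while_tm T i c M))"
    moreover obtain x as where z: "z = (x, as)" by (cases z)
    ultimately have nz: "table (while_tm T i c M) (x, as) \<noteq> None" by auto
    show "z \<in> ?D"
    proof (cases x)
      case 0
      then show ?thesis using nz z by (auto simp: while_tm_def split: if_splits)
    next
      case (Suc q)
      then have "(q, as) \<in> dom (table M) \<union> control M \<times> scans T"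
        using nz by (auto simp: while_tm_def split: option.splits if_splits)
      moreover have "z = (\<lambda>(q, as). (Suc q, as)) (q, as)" using Suc z by simp
      ultimately show ?thesis by blast
    qed
  qed
  moreover have "finite ?D"
    using assms finite_scans finite_control by (auto simp: wf_tm_def)
  ultimately show "finite (dom (table (while_tm T i c M)))" by (rule finite_subset)
next
  fix x as q acts
  assume *: "table (while_tm T i c M) (x, as) = Some (q, acts)"
  show "length as = tapes (while_tm T i c M) \<and> length acts = tapes (while_tm T i c M)"
    using * assms wf_tm_lengths[OF assms(1), of "x - 1" as]
    by (auto simp: while_tm_def scans_def split: option.splits if_splits nat.splits)
qed (use assms in \<open>simp add: while_tm_def wf_tm_def\<close>)

lemma implements_While:
  assumes M: "implements T M p" and i: "i < T"
  shows "implements T (while_tm T i c M) (While i c p)"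
proof -
  let ?S = "while_tm T i c M"
  have T: "tapes M = T" "tapes ?S = T"
    using assms by (auto simp: implements_def while_tm_def)
  have top: "bit_of (scan T s ! i) = top_bit (s i)" for s
    using i by (simp add: nth_scan bit_of_inscribe)
  \<comment> \<open>Stronger than halting: the run ends in the test state itself with the test
    failed, so the remaining iterations can be chained to the first one.\<close>
  have "(tm_step ?S)\<^sup>*\<^sup>* (0, stacks T s) (0, stacks T u) \<and> \<not> c (top_bit (u i))"
    if "exec (While i c p) s u" for s u
    using that
  proof (induction "While i c p" s u rule: exec.induct)
    case (exec_While_True s t u)
    obtain q where q: "(tm_step M)\<^sup>*\<^sup>* (0, stacks T s) (q, stacks T t)"
      "table M (q, scan T t) = None"
      using M exec_While_True.hyps(2) T unfolding implements_def halts_at_def by metis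
    have "tm_step ?S (0, stacks T s) (Suc 0, stacks T s)"
      using exec_While_True.hyps(1) by (intro jump_step) (simp add: while_tm_def top)
    moreover have "(tm_step ?S)\<^sup>*\<^sup>* (Suc 0, stacks T s) (Suc q, stacks T t)"
      by (rule embed_run[OF q(1)]) (simp add: while_tm_def)
    moreover have "q \<in> control M"
      using control_reachable[OF q(1)] by (simp add: control_def)
    then have "tm_step ?S (Suc q, stacks T t) (0, stacks T t)"
      using q(2) by (intro jump_step) (simp add: while_tm_def)
    ultimately have "(tm_step ?S)\<^sup>*\<^sup>* (0, stacks T s) (0, stacks T t)"
      by (meson converse_rtranclp_into_rtranclp rtranclp.rtrancl_into_rtrancl)
    then show ?case using exec_While_True.hyps by auto
  qed simp
  then have "halts_at ?S s u" if "exec (While i c p) s u" for s u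
    using that unfolding halts_at_def T(2)
    by (intro exI[of _ 0]) (auto simp: while_tm_def top)
  then show ?thesis
    using assms T wf_while_tm by (auto simp: implements_def)
qed

text \<open>Tapes outside the window are rewritten unchanged, and restricting their symbols keeps
  the table finite. The window is not restricted: the called machine may write marks while it runs,
  and its own finite table bounds these.\<close>

definition lift_tm :: "nat \<Rightarrow> nat \<Rightarrow> tm \<Rightarrow> tm" where
  "lift_tm T i M = \<lparr>tapes = T, table = (\<lambda>(q, as).
     if length as = T \<and> take i as \<in> scans i \<and> drop (i + tapes M) as \<in> scans (T - (i + tapes M))
     then map_option (\<lambda>(q', acts). (q', keep (take i as) @ acts @ keep (drop (i + tapes M) as)))
       (table M (q, take (tapes M) (drop i as)))
     else None)\<rparr>"

lemma wf_lift_tm: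
  assumes "wf_tm M" "i + tapes M \<le> T"
  shows "wf_tm (lift_tm T i M)"
proof (rule wf_tmI)
  let ?S = "lift_tm T i M"
  let ?k = "tapes M"
  have "dom (table ?S) \<subseteq> (\<lambda>((q, bs), as, cs). (q, as @ bs @ cs)) `
      (dom (table M) \<times> scans i \<times> scans (T - (i + ?k)))" (is "_ \<subseteq> ?D")
  proof
    fix z assume "z \<in> dom (table ?S)"
    moreover obtain q as where z: "z = (q, as)" by (cases z)
    ultimately have nz: "table ?S (q, as) \<noteq> None" by auto
    then have "((q, take ?k (drop i as)), take i as, drop (i + ?k) as) \<in>
        dom (table M) \<times> scans i \<times> scans (T - (i + ?k))"
      by (auto simp: lift_tm_def split: if_splits)
    moreover have "z = (\<lambda>((q, bs), as, cs). (q, as @ bs @ cs))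
        ((q, take ?k (drop i as)), take i as, drop (i + ?k) as)"
      using z append_take_drop_id[of i as] append_take_drop_id[of ?k "drop i as"]
      by (simp add: add.commute)
    ultimately show "z \<in> ?D" by blast
  qed
  moreover have "finite ?D"
    using assms finite_scans by (auto simp: wf_tm_def)
  ultimately show "finite (dom (table ?S))" by (rule finite_subset)
next
  fix q as q' acts
  assume *: "table (lift_tm T i M) (q, as) = Some (q', acts)"
  then obtain acts' where "table M (q, take (tapes M) (drop i as)) = Some (q', acts')"
    "acts = keep (take i as) @ acts' @ keep (drop (i + tapes M) as)" "length as = T"
    by (auto simp: lift_tm_def split: if_splits)
  then show "length as = tapes (lift_tm T i M) \<and> length acts = tapes (lift_tm T i M)"
    using assms wf_tm_lengths[of M] by (auto simp: lift_tm_def)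
qed (use assms in \<open>auto simp: lift_tm_def wf_tm_def\<close>)

lemma lift_tm_run:
  assumes "wf_tm M" "i + tapes M \<le> T" "(tm_step M)\<^sup>*\<^sup>* (q, ts) (q', ts')" "length ts = tapes M"
    and "length L = i" "map (\<lambda>t. t 0) L \<in> scans i"
    and "length R = T - (i + tapes M)" "map (\<lambda>t. t 0) R \<in> scans (T - (i + tapes M))"
  shows "(tm_step (lift_tm T i M))\<^sup>*\<^sup>* (q, L @ ts @ R) (q', L @ ts' @ R) \<and> length ts' = tapes M"
  using assms(3)
proof (induction "(q', ts')" arbitrary: q' ts' rule: rtranclp_induct)
  case (step c)
  obtain q1 ts1 where c: "c = (q1, ts1)" by (cases c)
  then have run: "(tm_step (lift_tm T i M))\<^sup>*\<^sup>* (q, L @ ts @ R) (q1, L @ ts1 @ R)"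
    and len: "length ts1 = tapes M"
    using step by auto
  obtain acts where acts: "table M (q1, map (\<lambda>t. t 0) ts1) = Some (q', acts)"
    "ts' = map2 act acts ts1"
    using step.hyps(2) c by (auto elim: tm_step.cases)
  have lacts: "length acts = tapes M" using acts(1) assms(1) wf_tm_lengths by blast
  have "tm_step (lift_tm T i M) (q1, L @ ts1 @ R) (q', L @ ts' @ R)"
  proof (rule tm_stepI)
    show "table (lift_tm T i M) (q1, map (\<lambda>t. t 0) (L @ ts1 @ R)) =
        Some (q', keep (map (\<lambda>t. t 0) L) @ acts @ keep (map (\<lambda>t. t 0) R))"
      using acts(1) len assms by (simp add: lift_tm_def)
    show "L @ ts' @ R =
        map2 act (keep (map (\<lambda>t. t 0) L) @ acts @ keep (map (\<lambda>t. t 0) R)) (L @ ts1 @ R)"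
      using acts(2) len lacts by simp
  qed
  then show ?case using run len lacts acts(2) by auto
qed (use assms in simp)

lemma implements_Call:
  assumes M: "wf_tm M" and i: "i + tapes M \<le> T"
  shows "implements T (lift_tm T i M) (Call M i)"
proof -
  let ?S = "lift_tm T i M"
  let ?k = "tapes M"
  have T: "tapes ?S = T" by (simp add: lift_tm_def)
  have k: "?k \<ge> 1" using M by (simp add: wf_tm_def)
  have "halts_at ?S s (s(i := v))"
    if out: "tm_out M [s i] v" and empty: "\<forall>j. i < j \<and> j < i + ?k \<longrightarrow> s j = []" for s v
  proof -
    define L where "L = map (\<lambda>j. inscribe (s j)) [0..<i]"
    define R where "R = map (\<lambda>j. inscribe (s j)) [i + ?k..<T]"
    have L: "length L = i" "map (\<lambda>t. t 0) L \<in> scans i"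
      using inscribe_0_bits by (auto simp: L_def scans_def)
    have R: "length R = T - (i + ?k)" "map (\<lambda>t. t 0) R \<in> scans (T - (i + ?k))"
      using inscribe_0_bits by (auto simp: R_def scans_def)
    \<comment> \<open>The stacks beside \<open>i\<close> in the window are empty, so the window is a
      standard configuration both before the call and after it.\<close>
    have split: "stacks T (s(i := w)) = L @ config M [w] @ R" for w
    proof (rule nth_equalityI)
      show "length (stacks T (s(i := w))) = length (L @ config M [w] @ R)"
        using i k by (simp add: L_def R_def config_def)
      fix j assume "j < length (stacks T (s(i := w)))"
      then have j: "j < T" by simp
      consider "j < i" | "j = i" | "i < j" "j < i + ?k" | "i + ?k \<le> j" by linarith
      then show "stacks T (s(i := w)) ! j = (L @ config M [w] @ R) ! j"
        using i j k empty
        by cases (auto simp: nth_append nth_Cons' L_def R_def config_def)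
    qed
    obtain q where q: "(tm_step M)\<^sup>*\<^sup>* (0, config M [s i]) (q, config M [v])"
      "table M (q, map (\<lambda>t. t 0) (config M [v])) = None"
      using out by (auto simp: tm_out_def)
    have "(tm_step ?S)\<^sup>*\<^sup>* (0, L @ config M [s i] @ R) (q, L @ config M [v] @ R)"
      using lift_tm_run[OF M i q(1) _ L R] k by (simp add: config_def)
    then have "(tm_step ?S)\<^sup>*\<^sup>* (0, stacks T s) (q, stacks T (s(i := v)))"
      using split[of "s i"] split[of v] by simp
    moreover have "table ?S (q, scan T (s(i := v))) = None"
    proof -
      have "length (config M [v]) = ?k" using k by (simp add: config_def)
      then have "take ?k (drop i (scan T (s(i := v)))) = map (\<lambda>t. t 0) (config M [v])"
        using L(1) by (simp add: scan_def split)
      then show ?thesis using q(2) by (simp add: lift_tm_def)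
    qed
    ultimately show ?thesis unfolding halts_at_def T by blast
  qed
  then show ?thesis
    using assms T wf_lift_tm by (auto simp: implements_def elim!: exec_CallE)
qed

theorem compile: "wf_prog T p \<Longrightarrow> \<exists>M. implements T M p"
proof (induction p)
  case (Push i b) then show ?case using implements_Push by auto
next
  case (Pop i) then show ?case using implements_Pop by auto
next
  case (Call M i) then show ?case using implements_Call by auto
next
  case (Seq p r) then show ?case using implements_Seq by fastforce
next
  case (Cond i c p r) then show ?case using implements_Cond by fastforce
next
  case (While i c p) then show ?case using implements_While by fastforce
qed

section \<open>An interpreter for derivation traces\<close>

abbreviation has_bit :: "bool option \<Rightarrow> bool" where
  "has_bit x \<equiv> x \<noteq> None"

abbreviation is_True :: "bool option \<Rightarrow> bool" where
  "is_True x \<equiv> x = Some True"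

lemma exec_eq: "exec p s t \<Longrightarrow> t = u \<Longrightarrow> exec p s u"
  by simp

lemma exec_While_step:
  "c (top_bit (s i)) \<Longrightarrow> exec p s t \<Longrightarrow> exec (While i c p) t u \<Longrightarrow> u = u' \<Longrightarrow>
    exec (While i c p) s u'"
  by (auto intro: exec_While_True)

section \<open>Moving bits and blocks between stacks\<close>

definition move :: "nat \<Rightarrow> nat \<Rightarrow> prog" where
  "move i j = Cond i is_True (Pop i ;; Push j True) (Pop i ;; Push j False)"

definition transfer :: "nat \<Rightarrow> nat \<Rightarrow> prog" where
  "transfer i j = While i has_bit (move i j)"

definition move_count :: "nat \<Rightarrow> nat \<Rightarrow> nat \<Rightarrow> prog" where
  "move_count c i j = While c has_bit (Pop c ;; move i j)"

definition block :: "bool list \<Rightarrow> bool list" where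
  "block w = replicate (length w) True @ False # w"

lemma list_code_simps [simp]:
  "list_code [] = []" "list_code (w # ws) = block w @ list_code ws"
  "list_code (ws @ ws') = list_code ws @ list_code ws'"
  by (simp_all add: list_code_def block_def)

text \<open>The unary header is counted on \<open>c\<close> as it passes, and the count then drives
  the body, so bits of the body are never taken for delimiters. The block arrives reversed; moving
  it back bit by bit restores it.\<close>

definition move_block :: "nat \<Rightarrow> nat \<Rightarrow> nat \<Rightarrow> prog" where
  "move_block c i j =
     While i is_True (Pop i ;; Push j True ;; Push c True) ;;
     Pop i ;; Push j False ;; move_count c i j"

lemma exec_move:
  assumes "s i = b # w" "i \<noteq> j"
  shows "exec (move i j) s (s(i := w, j := b # s j))"
proof -
  have "exec (Pop i ;; Push j b) s (s(i := w, j := b # s j))"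
    using exec_Seq[OF exec_Pop[of i s] exec_Push[of j b]] assms by simp
  then show ?thesis
    using assms unfolding move_def
    by (cases b) (auto intro: exec_Cond_True exec_Cond_False)
qed

lemma exec_transfer:
  assumes "i \<noteq> j"
  shows "exec (transfer i j) s (s(i := [], j := rev (s i) @ s j))"
proof (induction "s i" arbitrary: s)
  case Nil
  then show ?case
    unfolding transfer_def
    by (intro exec_eq[OF exec_While_False]) (auto simp: Nil[symmetric])
next
  case (Cons b w)
  let ?t = "s(i := w, j := b # s j)"
  have e1: "exec (transfer i j) ?t (?t(i := [], j := rev (?t i) @ ?t j))"
    using Cons.hyps(1) assms by (metis fun_upd_same fun_upd_twist)
  have e2: "?t(i := [], j := rev (?t i) @ ?t j) = s(i := [], j := rev (s i) @ s j)"
    using assms by (auto simp: Cons.hyps(2)[symmetric])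
  show ?case
    using exec_While_step[of has_bit s i, OF _ _ e1[unfolded transfer_def] e2]
      exec_move[of s i b w j] Cons.hyps(2)[symmetric] assms
    unfolding transfer_def by simp
qed

lemma exec_move_count:
  assumes "s i = u @ w" "length u = length (s c)" "i \<noteq> j" "c \<noteq> i" "c \<noteq> j"
  shows "exec (move_count c i j) s (s(c := [], i := w, j := rev u @ s j))"
  using assms(1,2)
proof (induction u arbitrary: s)
  case Nil
  then show ?case
    unfolding move_count_def
    by (intro exec_eq[OF exec_While_False]) auto
next
  case (Cons b u)
  then obtain d v where c: "s c = d # v" by (cases "s c") auto
  let ?t = "s(c := v)" let ?u = "s(c := v, i := u @ w, j := b # s j)"
  have e1: "exec (Pop c) s ?t" using exec_Pop[of c s] c by simp
  have e2: "exec (move i j) ?t ?u"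
    using exec_move[of ?t i b "u @ w" j] Cons.prems assms(3-5) by simp
  have e3: "exec (move_count c i j) ?u (?u(c := [], i := w, j := rev u @ ?u j))"
    using Cons.prems assms(3-5) c by (intro Cons.IH) auto
  have e4: "?u(c := [], i := w, j := rev u @ ?u j) = s(c := [], i := w, j := rev (b # u) @ s j)"
    using assms(3-5) by auto
  show ?case
    unfolding move_count_def
    by (rule exec_While_step[OF _ exec_Seq[OF e1 e2] e3[unfolded move_count_def] e4]) (simp add: c)
qed

lemma exec_move_header:
  assumes "s i = replicate n True @ False # r" "i \<noteq> j" "c \<noteq> i" "c \<noteq> j"
  shows "exec (While i is_True (Pop i ;; Push j True ;; Push c True)) s
    (s(i := False # r, j := replicate n True @ s j, c := replicate n True @ s c))"
  using assms(1)
proof (induction n arbitrary: s)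
  case 0
  then show ?case
    by (intro exec_eq[OF exec_While_False]) auto
next
  case (Suc n)
  let ?u = "s(i := replicate n True @ False # r, j := True # s j, c := True # s c)"
  have e1: "exec (Pop i ;; Push j True ;; Push c True) s ?u"
    using exec_Seq[OF exec_Pop[of i s] exec_Seq[OF exec_Push[of j True] exec_Push[of c True]]]
      Suc.prems assms(2-4) by simp
  have e2: "exec (While i is_True (Pop i ;; Push j True ;; Push c True)) ?u
      (?u(i := False # r, j := replicate n True @ ?u j, c := replicate n True @ ?u c))"
    using assms(2-4) by (intro Suc.IH) auto
  have e3: "?u(i := False # r, j := replicate n True @ ?u j, c := replicate n True @ ?u c) =
      s(i := False # r, j := replicate (Suc n) True @ s j, c := replicate (Suc n) True @ s c)"
    using assms(2-4) by (auto simp: replicate_app_Cons_same)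
  show ?case
    by (rule exec_While_step[OF _ e1 e2 e3]) (simp add: Suc.prems)
qed

lemma exec_move_block:
  assumes "s i = block w @ r" "s c = []" "i \<noteq> j" "c \<noteq> i" "c \<noteq> j"
  shows "exec (move_block c i j) s (s(i := r, j := rev (block w) @ s j))"
proof -
  let ?n = "length w"
  let ?t = "s(i := False # w @ r, j := replicate ?n True @ s j, c := replicate ?n True)"
  let ?u = "?t(i := w @ r, j := False # ?t j)"
  have e1: "exec (While i is_True (Pop i ;; Push j True ;; Push c True)) s ?t"
    using exec_move_header[of s i ?n "w @ r" j c] assms by (simp add: block_def)
  have e2: "exec (Pop i) ?t (?t(i := w @ r))"
    using exec_Pop[of i ?t] assms by simp
  have e3: "exec (Push j False) (?t(i := w @ r)) ?u"
    using exec_Push[of j False "?t(i := w @ r)"] assms by simp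
  have e4: "exec (move_count c i j) ?u (?u(c := [], i := r, j := rev w @ ?u j))"
    using assms by (intro exec_move_count) auto
  have e5: "?u(c := [], i := r, j := rev w @ ?u j) = s(i := r, j := rev (block w) @ s j)"
    using assms by (auto simp: block_def)
  show ?thesis
    unfolding move_block_def
    by (rule exec_eq[OF exec_Seq[OF e1 exec_Seq[OF e2 exec_Seq[OF e3 e4]]] e5])
qed

text \<open>Register use of the interpreter: 0 program and output, 1 the pool of formulas (newest first,
  in \<open>list_code\<close> form), 2 the decoded opcodes, 3 error flag, 6 a unary counter, 8 the argument list
  of the next rule, 4, 5, 7 auxiliary; stacks from 9 on are the scratch tapes of called machines.\<close>

definition double :: prog where
  "double = While 6 has_bit (Pop 6 ;; Push 7 True ;; Push 7 True) ;; transfer 7 6"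

text \<open>Reading a stack destroys it. The chosen block is taken to 5, which reverses it, and
  brought back onto both 1 and 8, while the blocks skipped before it wait on 4. It lands in front of
  the argument list, so arguments must be selected last to first.\<close>

definition select :: prog where
  "select =
     While 6 has_bit (Pop 6 ;; move_block 7 1 4) ;;
     move_block 7 1 5 ;;
     While 5 has_bit
       (Cond 5 is_True (Pop 5 ;; Push 1 True ;; Push 8 True) (Pop 5 ;; Push 1 False ;; Push 8 False)) ;;
     transfer 4 1"

text \<open>After the flag is popped, the conclusion has no header. Turning it over onto 4 counts
  its length on 7; the body and then the header are put on the pool, so the new formula stands
  first.\<close>

definition apply_rule :: "tm \<Rightarrow> prog" where
  "apply_rule M =
     Call M 8 ;; Pop 8 ;; While 8 has_bit (Push 7 True ;; move 8 4) ;; transfer 4 1 ;;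
     Push 1 False ;; transfer 7 1"

lemma exec_double:
  assumes "s 6 = replicate n True" "s 7 = []"
  shows "exec double s (s(6 := replicate (2 * n) True))"
proof -
  have loop: "exec (While 6 has_bit (Pop 6 ;; Push 7 True ;; Push 7 True)) s
      (s(6 := [], 7 := replicate (2 * n) True @ s 7))"
    if "s 6 = replicate n True" for s n
    using that
  proof (induction n arbitrary: s)
    case 0
    then show ?case by (intro exec_eq[OF exec_While_False]) auto
  next
    case (Suc n)
    let ?u = "s(6 := replicate n True, 7 := True # True # s 7)"
    have e1: "exec (Pop 6 ;; Push 7 True ;; Push 7 True) s ?u"
      using exec_Seq[OF exec_Pop[of 6 s] exec_Seq[OF exec_Push[of 7 True] exec_Push[of 7 True]]]
        Suc.prems by simp
    have e2: "exec (While 6 has_bit (Pop 6 ;; Push 7 True ;; Push 7 True)) ?u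
        (?u(6 := [], 7 := replicate (2 * n) True @ ?u 7))"
      by (intro Suc.IH) auto
    have e3: "?u(6 := [], 7 := replicate (2 * n) True @ ?u 7) =
        s(6 := [], 7 := replicate (2 * Suc n) True @ s 7)"
      by (auto simp: replicate_app_Cons_same)
    show ?case
      by (rule exec_While_step[OF _ e1 e2 e3]) (simp add: Suc.prems)
  qed
  let ?t = "s(6 := [], 7 := replicate (2 * n) True @ s 7)"
  have "exec (transfer 7 6) ?t (?t(7 := [], 6 := rev (?t 7) @ ?t 6))"
    by (rule exec_transfer) simp
  moreover have "?t(7 := [], 6 := rev (?t 7) @ ?t 6) = s(6 := replicate (2 * n) True)"
    using assms(2) by auto
  ultimately show ?thesis
    using exec_Seq[OF loop[of s n]] assms(1) unfolding double_def by simp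
qed

lemma exec_skip_blocks:
  assumes "s 6 = replicate (length ws) True" "s 1 = list_code ws @ r" "s 7 = []"
  shows "exec (While 6 has_bit (Pop 6 ;; move_block 7 1 4)) s
    (s(6 := [], 1 := r, 4 := rev (list_code ws) @ s 4))"
  using assms
proof (induction ws arbitrary: s)
  case Nil
  then show ?case by (intro exec_eq[OF exec_While_False]) auto
next
  case (Cons w ws)
  let ?n = "length ws"
  let ?t = "s(6 := replicate ?n True)"
  let ?u = "?t(1 := list_code ws @ r, 4 := rev (block w) @ ?t 4)"
  have e1: "exec (Pop 6) s ?t" using exec_Pop[of 6 s] Cons.prems by simp
  have e2: "exec (move_block 7 1 4) ?t ?u"
    using Cons.prems by (intro exec_move_block) auto
  have e3: "exec (While 6 has_bit (Pop 6 ;; move_block 7 1 4)) ?u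
      (?u(6 := [], 1 := r, 4 := rev (list_code ws) @ ?u 4))"
    using Cons.prems by (intro Cons.IH) auto
  have e4: "?u(6 := [], 1 := r, 4 := rev (list_code ws) @ ?u 4) =
      s(6 := [], 1 := r, 4 := rev (list_code (w # ws)) @ s 4)"
    by auto
  show ?case
    by (rule exec_While_step[OF _ exec_Seq[OF e1 e2] e3 e4]) (simp add: Cons.prems)
qed

lemma exec_copy:
  shows "exec (While 5 has_bit
      (Cond 5 is_True (Pop 5 ;; Push 1 True ;; Push 8 True) (Pop 5 ;; Push 1 False ;; Push 8 False))) s
    (s(5 := [], 1 := rev (s 5) @ s 1, 8 := rev (s 5) @ s 8))" (is "exec ?P s _")
proof (induction "s 5" arbitrary: s)
  case Nil
  then show ?case
    by (intro exec_eq[OF exec_While_False]) (auto simp: Nil[symmetric])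
next
  case (Cons b w)
  let ?u = "s(5 := w, 1 := b # s 1, 8 := b # s 8)"
  note s5 = Cons.hyps(2)[symmetric]
  have "exec (Pop 5 ;; Push 1 b ;; Push 8 b) s ?u"
    using exec_Seq[OF exec_Pop[of 5 s] exec_Seq[OF exec_Push[of 1 b] exec_Push[of 8 b]]] s5 by simp
  then have e1: "exec (Cond 5 is_True (Pop 5 ;; Push 1 True ;; Push 8 True)
      (Pop 5 ;; Push 1 False ;; Push 8 False)) s ?u"
    using s5 by (cases b) (auto intro: exec_Cond_True exec_Cond_False)
  have e2: "exec ?P ?u (?u(5 := [], 1 := rev (?u 5) @ ?u 1, 8 := rev (?u 5) @ ?u 8))"
    by (rule Cons.hyps(1)) simp
  have e3: "?u(5 := [], 1 := rev (?u 5) @ ?u 1, 8 := rev (?u 5) @ ?u 8) =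
      s(5 := [], 1 := rev (s 5) @ s 1, 8 := rev (s 5) @ s 8)"
    using s5 by auto
  show ?case
    by (rule exec_While_step[OF _ e1 e2 e3]) (simp add: s5)
qed

lemma exec_select:
  assumes "s 6 = replicate n True" "s 1 = list_code Q" "n < length Q"
    and "s 4 = []" "s 5 = []" "s 7 = []"
  shows "exec select s (s(6 := [], 8 := block (Q ! n) @ s 8))"
proof -
  define ws where "ws = take n Q"
  define ws' where "ws' = drop (Suc n) Q"
  define w where "w = Q ! n"
  have Q: "Q = ws @ w # ws'" and n: "length ws = n"
    using assms(3) by (auto simp: ws_def ws'_def w_def id_take_nth_drop)
  let ?t = "s(6 := [], 1 := block w @ list_code ws', 4 := rev (list_code ws) @ s 4)"
  let ?u = "?t(1 := list_code ws', 5 := rev (block w) @ ?t 5)"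
  let ?v = "?u(5 := [], 1 := rev (?u 5) @ ?u 1, 8 := rev (?u 5) @ ?u 8)"
  have e1: "exec (While 6 has_bit (Pop 6 ;; move_block 7 1 4)) s ?t"
    using assms Q n by (intro exec_skip_blocks) auto
  have e2: "exec (move_block 7 1 5) ?t ?u"
    using assms by (intro exec_move_block) auto
  note e3 = exec_copy[of ?u]
  have e4: "exec (transfer 4 1) ?v (?v(4 := [], 1 := rev (?v 4) @ ?v 1))"
    by (rule exec_transfer) simp
  have e5: "?v(4 := [], 1 := rev (?v 4) @ ?v 1) = s(6 := [], 8 := block (Q ! n) @ s 8)"
  proof -
    have "s 1 = list_code ws @ block w @ list_code ws'" using assms(2) Q by simp
    then show ?thesis
      using assms(4,5) unfolding w_def[symmetric] by (auto simp: fun_eq_iff)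
  qed
  show ?thesis
    unfolding select_def
    by (rule exec_eq[OF exec_Seq[OF e1 exec_Seq[OF e2 exec_Seq[OF e3 e4]]] e5])
qed

lemma exec_apply_rule:
  assumes "tm_out M [s 8] (True # w)" "\<forall>j>8. s j = []" "s 4 = []" "s 7 = []"
  shows "exec (apply_rule M) s (s(8 := [], 1 := block w @ s 1))"
proof -
  have loop: "exec (While 8 has_bit (Push 7 True ;; move 8 4)) s
      (s(8 := [], 7 := replicate (length (s 8)) True @ s 7, 4 := rev (s 8) @ s 4))" for s
  proof (induction "s 8" arbitrary: s)
    case Nil
    then show ?case
      by (intro exec_eq[OF exec_While_False]) (auto simp: Nil[symmetric])
  next
    case (Cons b w)
    note s8 = Cons.hyps(2)[symmetric]
    let ?t = "s(7 := True # s 7)"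
    let ?u = "?t(8 := w, 4 := b # ?t 4)"
    have e1: "exec (Push 7 True) s ?t" by (rule exec_Push)
    have e2: "exec (move 8 4) ?t ?u" using s8 by (intro exec_move) auto
    have e3: "exec (While 8 has_bit (Push 7 True ;; move 8 4)) ?u
        (?u(8 := [], 7 := replicate (length (?u 8)) True @ ?u 7, 4 := rev (?u 8) @ ?u 4))"
      by (rule Cons.hyps(1)) simp
    have e4: "?u(8 := [], 7 := replicate (length (?u 8)) True @ ?u 7, 4 := rev (?u 8) @ ?u 4) =
        s(8 := [], 7 := replicate (length (s 8)) True @ s 7, 4 := rev (s 8) @ s 4)"
      using s8 by (auto simp: replicate_app_Cons_same)
    show ?case
      by (rule exec_While_step[OF _ exec_Seq[OF e1 e2] e3 e4]) (simp add: s8)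
  qed
  let ?t = "s(8 := True # w)"
  let ?u = "s(8 := w)"
  let ?v = "?u(8 := [], 7 := replicate (length (?u 8)) True @ ?u 7, 4 := rev (?u 8) @ ?u 4)"
  let ?x = "?v(4 := [], 1 := rev (?v 4) @ ?v 1)"
  let ?y = "?x(1 := False # ?x 1)"
  have e1: "exec (Call M 8) s ?t" using assms by (intro exec_Call) auto
  have e2: "exec (Pop 8) ?t ?u" using exec_Pop[of 8 ?t] by simp
  note e3 = loop[of ?u]
  have e4: "exec (transfer 4 1) ?v ?x" by (rule exec_transfer) simp
  have e5: "exec (Push 1 False) ?x ?y" by (rule exec_Push)
  have e6: "exec (transfer 7 1) ?y (?y(7 := [], 1 := rev (?y 7) @ ?y 1))"
    by (rule exec_transfer) simp
  have e7: "?y(7 := [], 1 := rev (?y 7) @ ?y 1) = s(8 := [], 1 := block w @ s 1)"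
    using assms(3,4) by (auto simp: block_def)
  show ?thesis
    unfolding apply_rule_def
    by (rule exec_eq[OF exec_Seq[OF e1 exec_Seq[OF e2 exec_Seq[OF e3 exec_Seq[OF e4 exec_Seq[OF e5 e6]]]]] e7])
qed

section \<open>Opcode dispatch and the main loop\<close>

fun dispatch :: "prog list \<Rightarrow> prog" where
  "dispatch [] = Pop 2"
| "dispatch (p # ps) = Cond 2 is_True (Pop 2 ;; dispatch ps) (Pop 2 ;; p)"

text \<open>Unary is affordable: the number of opcodes is fixed by the calculus, so each has bounded
  length. Only pool positions grow with the trace, and these are not opcodes.\<close>

definition opcode :: "nat \<Rightarrow> bool list" where
  "opcode k = replicate k True @ [False]"

lemma exec_dispatch:
  assumes "k < length ps" "s 2 = opcode k @ r" "exec (ps ! k) (s(2 := r)) t"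
  shows "exec (dispatch ps) s t"
  using assms
proof (induction ps arbitrary: k s)
  case (Cons p ps)
  show ?case
  proof (cases k)
    case 0
    then have "exec (Pop 2) s (s(2 := r))"
      using Cons.prems exec_Pop[of 2 s] by (simp add: opcode_def)
    then have "exec (Pop 2 ;; p) s t"
      using Cons.prems(3) unfolding 0 nth_Cons_0 by (rule exec_Seq)
    then show ?thesis
      using 0 Cons.prems(2) by (auto simp: opcode_def intro: exec_Cond_False)
  next
    case (Suc k')
    let ?u = "s(2 := opcode k' @ r)"
    have "exec (Pop 2) s ?u"
      using Suc Cons.prems exec_Pop[of 2 s] by (simp add: opcode_def)
    moreover have "exec (dispatch ps) ?u t"
    proof (rule Cons.IH)
      show "exec (ps ! k') (?u(2 := r)) t"
        using Cons.prems(3) unfolding Suc nth_Cons_Suc fun_upd_upd .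
    qed (use Suc Cons.prems in auto)
    ultimately show ?thesis
      using Suc Cons.prems by (auto simp: opcode_def intro: exec_Cond_True exec_Seq)
  qed
qed simp

definition instructions :: "tm list \<Rightarrow> prog list" where
  "instructions Ms = [double, Push 6 True, select] @ map apply_rule Ms"

definition main_loop :: "tm list \<Rightarrow> prog" where
  "main_loop Ms = While 2 has_bit (dispatch (instructions Ms))"

text \<open>The invariant between instructions: all auxiliary and scratch stacks are empty, as the
  execution lemmas of the instructions require.\<close>

definition vm_state :: "bool list list \<Rightarrow> nat \<Rightarrow> bool list \<Rightarrow> bool list \<Rightarrow> nat \<Rightarrow> bool list" where
  "vm_state Q c a ops = (\<lambda>_. [])(1 := list_code Q, 2 := ops, 6 := replicate c True, 8 := a)"

text \<open>Stated from the run of the remaining program backwards, so that codes compose by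
  concatenation.\<close>

lemma main_loop_step:
  assumes "k < length (instructions Ms)" "exec (instructions Ms ! k) (vm_state Q c a ops) s"
    and "exec (main_loop Ms) s t"
  shows "exec (main_loop Ms) (vm_state Q c a (opcode k @ ops)) t"
proof -
  have "exec (dispatch (instructions Ms)) (vm_state Q c a (opcode k @ ops)) s"
  proof (rule exec_dispatch[OF assms(1)])
    have "(vm_state Q c a (opcode k @ ops))(2 := ops) = vm_state Q c a ops"
      by (auto simp: vm_state_def)
    then show "exec (instructions Ms ! k) ((vm_state Q c a (opcode k @ ops))(2 := ops)) s"
      using assms(2) by simp
  qed (simp add: vm_state_def)
  moreover have "has_bit (top_bit (vm_state Q c a (opcode k @ ops) 2))"
    by (cases k) (auto simp: vm_state_def opcode_def)
  ultimately show ?thesis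
    using assms(3) unfolding main_loop_def by (auto intro: exec_While_True)
qed

lemma main_loop_double:
  assumes "exec (main_loop Ms) (vm_state Q (2 * c) a ops) t"
  shows "exec (main_loop Ms) (vm_state Q c a (opcode 0 @ ops)) t"
proof (rule main_loop_step[OF _ _ assms])
  show "exec (instructions Ms ! 0) (vm_state Q c a ops) (vm_state Q (2 * c) a ops)"
    using exec_double[of "vm_state Q c a ops" c]
    by (simp add: instructions_def vm_state_def fun_upd_twist)
qed (simp add: instructions_def)

lemma main_loop_increment:
  assumes "exec (main_loop Ms) (vm_state Q (Suc c) a ops) t"
  shows "exec (main_loop Ms) (vm_state Q c a (opcode 1 @ ops)) t"
proof (rule main_loop_step[OF _ _ assms])
  show "exec (instructions Ms ! 1) (vm_state Q c a ops) (vm_state Q (Suc c) a ops)"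
    using exec_Push[of 6 True "vm_state Q c a ops"]
    by (simp add: instructions_def vm_state_def fun_upd_twist)
qed (simp add: instructions_def)

lemma main_loop_select:
  assumes "exec (main_loop Ms) (vm_state Q 0 (block (Q ! c) @ a) ops) t" "c < length Q"
  shows "exec (main_loop Ms) (vm_state Q c a (opcode 2 @ ops)) t"
proof (rule main_loop_step[OF _ _ assms(1)])
  show "exec (instructions Ms ! 2) (vm_state Q c a ops) (vm_state Q 0 (block (Q ! c) @ a) ops)"
    using exec_select[of "vm_state Q c a ops" c Q] assms(2)
    by (simp add: instructions_def vm_state_def fun_upd_twist)
qed (simp add: instructions_def)

lemma main_loop_apply:
  assumes "exec (main_loop Ms) (vm_state (w # Q) 0 [] ops) t"
    and "r < length Ms" "tm_out (Ms ! r) [a] (True # w)"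
  shows "exec (main_loop Ms) (vm_state Q 0 a (opcode (3 + r) @ ops)) t"
proof (rule main_loop_step[OF _ _ assms(1)])
  have "exec (apply_rule (Ms ! r)) (vm_state Q 0 a ops)
      ((vm_state Q 0 a ops)(8 := [], 1 := block w @ vm_state Q 0 a ops 1))"
    using assms(3) by (intro exec_apply_rule) (auto simp: vm_state_def)
  moreover have "(vm_state Q 0 a ops)(8 := [], 1 := block w @ vm_state Q 0 a ops 1) =
      vm_state (w # Q) 0 [] ops"
    by (auto simp: vm_state_def)
  ultimately show "exec (instructions Ms ! (3 + r)) (vm_state Q 0 a ops) (vm_state (w # Q) 0 [] ops)"
    using assms(2) by (simp add: instructions_def)
qed (use assms(2) in \<open>simp add: instructions_def\<close>)

section \<open>A prefix code and its total decoder\<close>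

fun double_bits :: "bool list \<Rightarrow> bool list" where
  "double_bits [] = [False]"
| "double_bits (b # w) = True # b # double_bits w"

lemma length_double_bits: "length (double_bits w) = 2 * length w + 1"
  by (induction w) auto

text \<open>\<open>True\<close> announces a further bit and \<open>False\<close> closes the word, so
  the end of a codeword is recognized without looking past it.\<close>

lemma prefix_double_bits: "prefix (double_bits v) (double_bits w) \<Longrightarrow> v = w"
proof (induction v arbitrary: w)
  case Nil
  then show ?case by (cases w) auto
next
  case (Cons b v)
  then show ?case by (cases w) auto
qed

definition skip :: prog where
  "skip = While 0 (\<lambda>_. False) (Pop 0)"

lemma exec_skip: "exec skip s s"
  unfolding skip_def by (rule exec_While_False) simp

definition decode_loop :: prog where
  "decode_loop = While 0 is_True (Pop 0 ;; Cond 0 has_bit (move 0 2) (Push 3 True))"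

definition decode :: prog where
  "decode =
     decode_loop ;;
     Cond 0 (\<lambda>x. x = Some False)
       (Pop 0 ;; Cond 0 has_bit (Push 3 True) skip)
       (Push 3 True)"

lemma exec_decode_loop_Nil:
  "\<not> is_True (top_bit (s 0)) \<Longrightarrow> exec decode_loop s s"
  unfolding decode_loop_def by (rule exec_While_False)

lemma exec_decode_loop_Cons:
  assumes "s 0 = True # b # p" "exec decode_loop (s(0 := p, 2 := b # s 2)) t"
  shows "exec decode_loop s t"
proof -
  let ?t = "s(0 := b # p)" let ?u = "s(0 := p, 2 := b # s 2)"
  have "exec (Pop 0) s ?t" using exec_Pop[of 0 s] assms by simp
  moreover have "exec (Cond 0 has_bit (move 0 2) (Push 3 True)) ?t ?u"
    using exec_move[of ?t 0 b p 2] by (intro exec_Cond_True) auto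
  ultimately have "exec (Pop 0 ;; Cond 0 has_bit (move 0 2) (Push 3 True)) s ?u"
    by (rule exec_Seq)
  then show ?thesis
    using assms exec_While_True[where i = 0 and s = s and t = ?u and u = t]
    unfolding decode_loop_def by simp
qed

text \<open>Arbitrary input must be covered, since rejection needs a terminating run. The outcomes
  are an error flag for an announced bit that is missing, an input used up without a terminator, and
  a terminator followed by an unread rest \<open>r\<close>.\<close>

lemma exec_decode_loop:
  "\<exists>t. exec decode_loop s t \<and>
     (t 3 \<noteq> [] \<or> t 0 = [] \<or>
      (\<exists>w r. s 0 = double_bits w @ r \<and> t = s(0 := False # r, 2 := rev w @ s 2)))"
proof (induction s rule: measure_induct_rule[where f = "\<lambda>s. length (s 0)"])
  case (less s)
  consider "s 0 = []" | r where "s 0 = False # r" | "s 0 = [True]" |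
      b p where "s 0 = True # b # p"
  proof -
    show ?thesis
    proof (cases "s 0")
      case (Cons a l)
      then show ?thesis using that by (cases a; cases l) auto
    qed (use that in auto)
  qed
  then show ?case
  proof cases
    case 1
    then show ?thesis by (intro exI[of _ s] conjI exec_decode_loop_Nil) auto
  next
    case 2
    have "s 0 = double_bits [] @ r \<and> s = s(0 := False # r, 2 := rev [] @ s 2)"
      using 2 by auto
    moreover have "exec decode_loop s s" using 2 by (intro exec_decode_loop_Nil) simp
    ultimately show ?thesis by blast
  next
    case 3
    let ?t = "s(0 := [])" let ?u = "?t(3 := True # ?t 3)"
    have "exec (Pop 0) s ?t" using exec_Pop[of 0 s] 3 by simp
    moreover have "exec (Cond 0 has_bit (move 0 2) (Push 3 True)) ?t ?u"
      by (intro exec_Cond_False exec_Push) auto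
    ultimately have "exec (Pop 0 ;; Cond 0 has_bit (move 0 2) (Push 3 True)) s ?u"
      by (rule exec_Seq)
    moreover have "exec decode_loop ?u ?u" by (rule exec_decode_loop_Nil) simp
    ultimately have "exec decode_loop s ?u"
      using 3 exec_While_True[where i = 0 and s = s and t = ?u and u = ?u]
      unfolding decode_loop_def by simp
    then show ?thesis by (intro exI conjI) (assumption, simp)
  next
    case 4
    let ?u = "s(0 := p, 2 := b # s 2)"
    have "length (?u 0) < length (s 0)" using 4 by simp
    from less.IH[of ?u, OF this] obtain t where t: "exec decode_loop ?u t \<and>
      (t 3 \<noteq> [] \<or> t 0 = [] \<or>
        (\<exists>w r. ?u 0 = double_bits w @ r \<and> t = ?u(0 := False # r, 2 := rev w @ ?u 2)))"
      by (rule exE)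
    have "exec decode_loop s t" using exec_decode_loop_Cons[of s b p t] 4 t by simp
    moreover have "\<exists>w r. s 0 = double_bits w @ r \<and> t = s(0 := False # r, 2 := rev w @ s 2)"
      if "?u 0 = double_bits w @ r" "t = ?u(0 := False # r, 2 := rev w @ ?u 2)" for w r
      using that 4 by (intro exI[of _ "b # w"] exI[of _ r]) auto
    ultimately show ?thesis using t by blast
  qed
qed

lemma exec_decode:
  "\<exists>t. exec decode s t \<and>
     (t 3 \<noteq> [] \<or> (\<exists>w. s 0 = double_bits w \<and> t = s(0 := [], 2 := rev w @ s 2)))"
proof -
  obtain t where t: "exec decode_loop s t"
    "t 3 \<noteq> [] \<or> t 0 = [] \<or>
      (\<exists>w r. s 0 = double_bits w @ r \<and> t = s(0 := False # r, 2 := rev w @ s 2))"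
    using exec_decode_loop by blast
  \<comment> \<open>No terminator, bits left behind the terminator, or a clean end; the first two
    raise the error flag. \<open>remdups_adj.cases\<close> serves only to split a list into empty,
    singleton and longer.\<close>
  consider "top_bit (t 0) \<noteq> Some False" | b r where "t 0 = False # b # r" | "t 0 = [False]"
    by (cases "t 0" rule: remdups_adj.cases) auto
  then show ?thesis
  proof cases
    case 1
    then have "exec decode s (t(3 := True # t 3))"
      unfolding decode_def by (intro exec_Seq[OF t(1)] exec_Cond_False exec_Push) auto
    then show ?thesis by (intro exI conjI) (assumption, simp)
  next
    case 2
    let ?u = "t(0 := b # r)"
    have e1: "exec (Pop 0) t ?u" using exec_Pop[of 0 t] 2 by simp
    have e2: "exec (Cond 0 has_bit (Push 3 True) skip) ?u (?u(3 := True # ?u 3))"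
      by (intro exec_Cond_True exec_Push) simp
    have "exec decode s (?u(3 := True # ?u 3))"
      unfolding decode_def
      by (rule exec_Seq[OF t(1) exec_Cond_True[OF _ exec_Seq[OF e1 e2]]]) (simp add: 2)
    then show ?thesis by (intro exI conjI) (assumption, simp)
  next
    case 3
    let ?u = "t(0 := [])"
    have e1: "exec (Pop 0) t ?u" using exec_Pop[of 0 t] 3 by simp
    have e2: "exec (Cond 0 has_bit (Push 3 True) skip) ?u ?u"
      by (intro exec_Cond_False exec_skip) simp
    have "exec decode s ?u"
      unfolding decode_def
      by (rule exec_Seq[OF t(1) exec_Cond_True[OF _ exec_Seq[OF e1 e2]]]) (simp add: 3)
    moreover have "?u 3 \<noteq> [] \<or> (\<exists>w. s 0 = double_bits w \<and> ?u = s(0 := [], 2 := rev w @ s 2))"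
    proof (cases "t 3 = []")
      case True
      then obtain w r where wr: "s 0 = double_bits w @ r" "t = s(0 := False # r, 2 := rev w @ s 2)"
        using t(2) 3 by auto
      then have "r = []" using 3 by simp
      then show ?thesis using wr by (intro disjI2 exI[of _ w]) auto
    qed simp
    ultimately show ?thesis by blast
  qed
qed

lemma exec_decode_double_bits:
  assumes "s 0 = double_bits w"
  shows "exec decode s (s(0 := [], 2 := rev w @ s 2))"
proof -
  have loop: "exec decode_loop s (s(0 := [False], 2 := rev w @ s 2))" if "s 0 = double_bits w" for s
    using that
  proof (induction w arbitrary: s)
    case Nil
    then show ?case
      using exec_decode_loop_Nil[of s] by (intro exec_eq[OF exec_decode_loop_Nil]) auto
  next
    case (Cons b w)
    let ?u = "s(0 := double_bits w, 2 := b # s 2)"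
    have "exec decode_loop ?u (?u(0 := [False], 2 := rev w @ ?u 2))"
      by (rule Cons.IH) simp
    then have "exec decode_loop s (?u(0 := [False], 2 := rev w @ ?u 2))"
      using Cons.prems by (intro exec_decode_loop_Cons[of s b "double_bits w"]) auto
    moreover have "?u(0 := [False], 2 := rev w @ ?u 2) = s(0 := [False], 2 := rev (b # w) @ s 2)"
      by auto
    ultimately show ?case by metis
  qed
  let ?t = "s(0 := [False], 2 := rev w @ s 2)" let ?u = "s(0 := [], 2 := rev w @ s 2)"
  have e1: "exec (Pop 0) ?t ?u" using exec_Pop[of 0 ?t] by (simp add: fun_upd_twist)
  have e2: "exec (Cond 0 has_bit (Push 3 True) skip) ?u ?u"
    by (intro exec_Cond_False exec_skip) simp
  show ?thesis
    unfolding decode_def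
    by (rule exec_Seq[OF loop[of s, OF assms] exec_Cond_True[OF _ exec_Seq[OF e1 e2]]]) simp
qed

section \<open>Loading the base and emitting the result\<close>

definition load :: "tm \<Rightarrow> prog" where
  "load M = transfer 1 4 ;; transfer 4 8 ;; Call M 8 ;; transfer 8 4 ;; transfer 4 1"

text \<open>Each passage through 4 reverses twice and so keeps the order. The base code is taken to
  8 because the stacks above it are blank, whereas stack 2, next to stack 1, already holds the
  opcodes.\<close>

lemma exec_load:
  assumes "tm_out M [s 1] v" "s 4 = []" "\<forall>j\<ge>8. s j = []"
  shows "exec (load M) s (s(1 := v))"
proof -
  let ?a = "s(1 := [], 4 := rev (s 1) @ s 4)"
  let ?b = "?a(4 := [], 8 := rev (?a 4) @ ?a 8)"
  let ?c = "?b(8 := v)"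
  let ?d = "?c(8 := [], 4 := rev (?c 8) @ ?c 4)"
  let ?e = "?d(4 := [], 1 := rev (?d 4) @ ?d 1)"
  have 1: "exec (transfer 1 4) s ?a" by (rule exec_transfer) simp
  have 2: "exec (transfer 4 8) ?a ?b" by (rule exec_transfer) simp
  have 3: "exec (Call M 8) ?b ?c" using assms by (intro exec_Call) auto
  have 4: "exec (transfer 8 4) ?c ?d" by (rule exec_transfer) simp
  have 5: "exec (transfer 4 1) ?d ?e" by (rule exec_transfer) simp
  have 6: "?e = s(1 := v)" using assms by (auto simp: fun_eq_iff)
  show ?thesis
    unfolding load_def
    by (rule exec_eq[OF exec_Seq[OF 1 exec_Seq[OF 2 exec_Seq[OF 3 exec_Seq[OF 4 5]]]] 6])
qed

text \<open>A standard output configuration has no header on the result and every other tape blank,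
  so the pool has to be erased as well.\<close>

definition emit :: prog where
  "emit =
     While 8 is_True (Pop 8) ;; Pop 8 ;; transfer 8 4 ;; transfer 4 0 ;; While 1 has_bit (Pop 1)"

lemma exec_emit:
  assumes "s 8 = block w" "s 4 = []" "s 0 = []"
  shows "exec emit s (s(8 := [], 0 := w, 1 := []))"
proof -
  have header: "exec (While 8 is_True (Pop 8)) s (s(8 := False # w))"
    if "s 8 = replicate n True @ False # w" for s n
    using that
  proof (induction n arbitrary: s)
    case 0
    then show ?case by (intro exec_eq[OF exec_While_False]) auto
  next
    case (Suc n)
    let ?u = "s(8 := replicate n True @ False # w)"
    have "exec (Pop 8) s ?u" using exec_Pop[of 8 s] Suc.prems by simp
    moreover have "exec (While 8 is_True (Pop 8)) ?u (?u(8 := False # w))"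
      by (rule Suc.IH) simp
    moreover have "?u(8 := False # w) = s(8 := False # w)" by simp
    ultimately show ?case
      using exec_While_step[of is_True s 8 "Pop 8"] Suc.prems by fastforce
  qed
  have clear: "exec (While 1 has_bit (Pop 1)) s (s(1 := []))" for s
  proof (induction "s 1" arbitrary: s)
    case Nil
    then show ?case by (intro exec_eq[OF exec_While_False]) (auto simp: Nil[symmetric])
  next
    case (Cons b v)
    let ?u = "s(1 := v)"
    have e1: "exec (Pop 1) s ?u"
      using exec_Pop[of 1 s] Cons.hyps(2)[symmetric] by simp
    have e2: "exec (While 1 has_bit (Pop 1)) ?u (?u(1 := []))"
      by (rule Cons.hyps(1)) simp
    have e3: "?u(1 := []) = s(1 := [])" by simp
    show ?case
      by (rule exec_While_step[OF _ e1 e2 e3]) (use Cons.hyps(2)[symmetric] in simp)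
  qed
  let ?a = "s(8 := False # w)"
  let ?b = "s(8 := w)"
  let ?c = "?b(8 := [], 4 := rev (?b 8) @ ?b 4)"
  let ?d = "?c(4 := [], 0 := rev (?c 4) @ ?c 0)"
  have 1: "exec (While 8 is_True (Pop 8)) s ?a"
    using header[of s "length w"] assms by (simp add: block_def)
  have 2: "exec (Pop 8) ?a ?b" using exec_Pop[of 8 ?a] by simp
  have 3: "exec (transfer 8 4) ?b ?c" by (rule exec_transfer) simp
  have 4: "exec (transfer 4 0) ?c ?d" by (rule exec_transfer) simp
  have 5: "exec (While 1 has_bit (Pop 1)) ?d (?d(1 := []))" by (rule clear)
  have 6: "?d(1 := []) = s(8 := [], 0 := w, 1 := [])" using assms by auto
  show ?thesis
    unfolding emit_def
    by (rule exec_eq[OF exec_Seq[OF 1 exec_Seq[OF 2 exec_Seq[OF 3 exec_Seq[OF 4 5]]]] 6])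
qed

section \<open>The interpreter as a prefix machine\<close>

definition interpreter :: "tm \<Rightarrow> tm list \<Rightarrow> prog" where
  "interpreter M Ms =
     decode ;; Cond 3 has_bit skip (load M ;; main_loop Ms ;; emit)"

definition input_state :: "bool list \<Rightarrow> bool list \<Rightarrow> nat \<Rightarrow> bool list" where
  "input_state p y = (\<lambda>_. [])(0 := p, 1 := y)"

lemma stacks_input:
  "tapes M \<ge> 2 \<Longrightarrow> config M [p, y] = stacks (tapes M) (input_state p y)"
  by (rule nth_equalityI)
    (auto simp: config_def input_state_def nth_append nth_Cons' split: if_splits)

lemma stacks_output:
  "tapes M \<ge> 2 \<Longrightarrow> config M [w] = stacks (tapes M) (input_state w [])"
  by (rule nth_equalityI)
    (auto simp: config_def input_state_def nth_append nth_Cons' split: if_splits)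

lemma wf_interpreter:
  assumes "wf_tm M" "\<forall>N\<in>set Ms. wf_tm N" "\<forall>N\<in>set (M # Ms). 8 + tapes N \<le> T"
  shows "wf_prog T (interpreter M Ms)"
proof -
  have T: "9 \<le> T" using assms by (force simp: wf_tm_def)
  have tr: "wf_prog T (transfer i j)" if "i < T" "j < T" for i j
    using that by (simp add: transfer_def move_def)
  have mb: "wf_prog T (move_block c i j)" if "i < T" "j < T" "c < T" for i j c
    using that by (simp add: move_block_def move_count_def move_def)
  have dis: "wf_prog T (dispatch ps)" if "\<forall>p\<in>set ps. wf_prog T p" for ps
    using that T by (induction ps) auto
  have "\<forall>p\<in>set (instructions Ms). wf_prog T p"
    using T assms
    by (auto simp: instructions_def double_def select_def apply_rule_def tr mb) (simp add: move_def)
  then show ?thesis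
    using T assms dis
    by (simp add: interpreter_def decode_def decode_loop_def skip_def load_def main_loop_def
      emit_def tr) (simp add: move_def)
qed

text \<open>Nothing is claimed about what a codeword does. For prefix-freeness it is enough that
  every program with an output, whatever \<open>y\<close> is, belongs to one prefix code.\<close>

lemma interpreter_output_imp_double_bits:
  assumes "implements T N (interpreter M Ms)" "T \<ge> 9" "tm_out N [p, y] x"
  shows "\<exists>w. p = double_bits w"
proof (rule ccontr)
  assume no: "\<nexists>w. p = double_bits w"
  have T: "tapes N = T" using assms(1) by (simp add: implements_def)
  let ?s = "input_state p y"
  have "?s 0 = p" by (simp add: input_state_def)
  then obtain t where t: "exec decode ?s t" "t 3 \<noteq> []"
    using exec_decode[of ?s] no by auto
  then have "exec (interpreter M Ms) ?s t"
    unfolding interpreter_def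
    by (intro exec_Seq[OF t(1)] exec_Cond_True exec_skip) (cases "t 3"; auto)
  then have "halts_at N ?s t" using assms(1) by (simp add: implements_def)
  then obtain q where q: "(tm_step N)\<^sup>*\<^sup>* (0, stacks T ?s) (q, stacks T t)"
    "halted N (q, stacks T t)"
    by (auto simp: halts_at_def T halted_def scan_def)
  obtain q' where q': "(tm_step N)\<^sup>*\<^sup>* (0, stacks T ?s) (q', stacks T (input_state x []))"
    "halted N (q', stacks T (input_state x []))"
    using assms(2,3) by (auto simp: tm_out_def stacks_input stacks_output T halted_def)
  \<comment> \<open>Both are halting configurations of the same run, yet tape 3 carries the error
    flag in one and is blank in the other.\<close>
  have "stacks T t = stacks T (input_state x [])"
    using halting_unique[OF q q'] by simp
  then have "stacks T t ! 3 = stacks T (input_state x []) ! 3" by simp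
  then show False
    using t(2) assms(2) by (simp add: input_state_def inscribe_eq_Nil_iff)
qed

lemma interpreter_prefix_machine:
  assumes "implements T N (interpreter M Ms)" "T \<ge> 9"
  shows "prefix_machine N"
  unfolding prefix_machine_def
proof (intro conjI allI impI)
  show "wf_tm N" using assms(1) by (simp add: implements_def)
  fix y p p' x x'
  assume "tm_out N [p, y] x \<and> tm_out N [p', y] x' \<and> prefix p p'"
  then show "p = p'"
    using interpreter_output_imp_double_bits[OF assms] prefix_double_bits by metis
qed

text \<open>Decoding pops from one stack and pushes onto another, which reverses the program; hence
  the input carries \<open>rev ops\<close>.\<close>

lemma interpreter_outputs:
  assumes "implements T N (interpreter M Ms)" "T \<ge> 9"
    and "tm_out M [y] (list_code Q)"
    and "exec (main_loop Ms) (vm_state Q 0 [] ops) (vm_state Q' 0 (block x) [])"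
  shows "tm_out N [double_bits (rev ops), y] x"
proof -
  have T: "tapes N = T" using assms(1) by (simp add: implements_def)
  let ?s = "input_state (double_bits (rev ops)) y"
  let ?a = "?s(0 := [], 2 := ops)"
  let ?b = "vm_state Q 0 [] ops"
  let ?c = "vm_state Q' 0 (block x) []"
  have 1: "exec decode ?s ?a"
    using exec_decode_double_bits[of ?s "rev ops"] by (simp add: input_state_def)
  have b: "?a(1 := list_code Q) = ?b" by (auto simp: input_state_def vm_state_def)
  have 2: "exec (load M) ?a ?b"
    using exec_load[of M ?a "list_code Q"] assms(3) unfolding b by (simp add: input_state_def)
  have c: "?c(8 := [], 0 := x, 1 := []) = input_state x []"
    by (auto simp: input_state_def vm_state_def)
  have 3: "exec emit ?c (input_state x [])"
    using exec_emit[of ?c x] unfolding c by (simp add: vm_state_def)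
  have "exec (Cond 3 has_bit skip (load M ;; main_loop Ms ;; emit)) ?a (input_state x [])"
    by (rule exec_Cond_False[OF _ exec_Seq[OF 2 exec_Seq[OF assms(4) 3]]])
      (simp add: input_state_def)
  from exec_Seq[OF 1 this] have "exec (interpreter M Ms) ?s (input_state x [])"
    by (simp add: interpreter_def)
  then have "halts_at N ?s (input_state x [])" using assms(1) by (simp add: implements_def)
  then show ?thesis
    using assms(2) by (auto simp: tm_out_def halts_at_def stacks_input stacks_output T scan_def)
qed

section \<open>Encoding of traces and the complexity bounds\<close>

text \<open>Horner's scheme on the binary digits, most significant first: from counter 0, each digit
  doubles and a digit 1 also increments. The code is logarithmic although the counter it produces is
  unary.\<close>

fun index_code :: "nat \<Rightarrow> bool list" where
  "index_code n =
     (if n = 0 then [] else index_code (n div 2) @ opcode 0 @ (if odd n then opcode 1 else []))"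

declare index_code.simps [simp del]

text \<open>Reversed because \<open>select\<close> puts each block in front of those already
  fetched.\<close>

definition args_code :: "nat list \<Rightarrow> bool list" where
  "args_code ns = concat (map (\<lambda>n. index_code n @ opcode 2) (rev ns))"

lemma main_loop_index:
  assumes "exec (main_loop Ms) (vm_state Q n a ops) t"
  shows "exec (main_loop Ms) (vm_state Q 0 a (index_code n @ ops)) t"
  using assms
proof (induction n arbitrary: ops rule: index_code.induct)
  case (1 n)
  show ?case
  proof (cases "n = 0")
    case True
    then show ?thesis using 1 by (simp add: index_code.simps)
  next
    case False
    let ?bit = "if odd n then opcode 1 else []"
    have "exec (main_loop Ms) (vm_state Q (2 * (n div 2)) a (?bit @ ops)) t"
    proof (cases "odd n")
      case True
      then have "Suc (2 * (n div 2)) = n" by simp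
      then show ?thesis
        using True main_loop_increment[of Ms Q "2 * (n div 2)" a ops t] 1(2) by simp
    qed (use 1(2) in simp)
    then have "exec (main_loop Ms) (vm_state Q 0 a (index_code (n div 2) @ opcode 0 @ ?bit @ ops)) t"
      using False by (intro 1(1) main_loop_double) auto
    then show ?thesis using False by (subst index_code.simps) simp
  qed
qed

lemma main_loop_args:
  assumes "\<forall>n\<in>set ns. n < length Q"
    and "exec (main_loop Ms) (vm_state Q 0 (list_code (map ((!) Q) ns) @ a) ops) t"
  shows "exec (main_loop Ms) (vm_state Q 0 a (args_code ns @ ops)) t"
  using assms
proof (induction ns arbitrary: ops)
  case Nil
  then show ?case by (simp add: args_code_def)
next
  case (Cons n ns)
  have "exec (main_loop Ms)
      (vm_state Q 0 (list_code (map ((!) Q) ns) @ a) (index_code n @ opcode 2 @ ops)) t"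
    using Cons.prems by (intro main_loop_index main_loop_select) auto
  then have "exec (main_loop Ms) (vm_state Q 0 a (args_code ns @ index_code n @ opcode 2 @ ops)) t"
    using Cons.prems(1) by (intro Cons.IH) auto
  then show ?case by (simp add: args_code_def)
qed

text \<open>A binary digit costs one bit for doubling and at most two for incrementing, and there
  are at most \<open>log 2 n + 1\<close> digits.\<close>

lemma length_index_code:
  "n \<ge> 1 \<Longrightarrow> real (length (index_code n)) \<le> 3 * log 2 (real n) + 3"
proof (induction n rule: less_induct)
  case (less n)
  have len: "length (index_code n) \<le> length (index_code (n div 2)) + 3"
    using less.prems by (subst index_code.simps) (simp add: opcode_def)
  show ?case
  proof (cases "n = 1")
    case True
    then show ?thesis using len by (simp add: index_code.simps[of 0])
  next
    case False
    then have half: "1 \<le> n div 2" "n div 2 < n" using less.prems by auto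
    have "log 2 (real (n div 2)) \<le> log 2 (real n / 2)"
    proof -
      have "real (2 * (n div 2)) \<le> real n" by (rule of_nat_mono) simp
      then show ?thesis using half by (intro log_mono) auto
    qed
    also have "\<dots> = log 2 (real n) - 1" using less.prems by (simp add: log_divide)
    finally show ?thesis using less.IH[OF half(2,1)] len by simp
  qed
qed

lemma one_le_log: "2 \<le> x \<Longrightarrow> 1 \<le> log 2 (x :: real)"
  by (simp add: le_log_iff)

text \<open>The 9 is 6 + 3: the index takes at most \<open>3 * log 2 L + 3\<close> bits and
  \<open>opcode 2\<close> takes 3, and constants are at most their multiples of
  \<open>log 2 L \<ge> 1\<close>.\<close>

lemma length_select_code:
  assumes "real n < L" "2 \<le> L"
  shows "real (length (index_code n @ opcode 2)) \<le> 9 * log 2 L"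
proof -
  have L: "1 \<le> log 2 L" using assms(2) by (rule one_le_log)
  have "real (length (index_code n)) \<le> 6 * log 2 L"
  proof (cases "n = 0")
    case True
    then show ?thesis using L by (simp add: index_code.simps)
  next
    case False
    then have "log 2 (real n) \<le> log 2 L" using assms by (intro log_mono) auto
    then show ?thesis using length_index_code[of n] False L by simp
  qed
  then show ?thesis using L by (simp add: opcode_def)
qed

lemma length_args_code:
  assumes "\<forall>n\<in>set ns. real n < L" "2 \<le> L"
  shows "real (length (args_code ns)) \<le> real (length ns) * (9 * log 2 L)"
  using assms(1)
proof (induction ns)
  case (Cons n ns)
  have "real (length (index_code n @ opcode 2)) \<le> 9 * log 2 L"
    using Cons.prems assms(2) by (intro length_select_code) auto
  then show ?case using Cons by (simp add: args_code_def algebra_simps)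
qed (simp add: args_code_def)

section \<open>From traces to short programs\<close>

locale rule_machines =
  fixes \<Sigma> :: signature and A :: ambient and P :: calculus and Ms :: "tm list"
  assumes calculus: "effective_calculus \<Sigma> A P"
    and machines: "\<And>r. r \<in> rules P \<Longrightarrow> r < length Ms \<and>
      (\<forall>ps. set ps \<subseteq> FO_LFP \<Sigma> \<longrightarrow>
        tm_out (Ms ! r) [list_code (map (enc A) ps)]
          (case conclusion P r ps of None \<Rightarrow> [] | Some \<phi> \<Rightarrow> True # enc A \<phi>))"
begin

text \<open>Per premise the 9 of \<open>length_select_code\<close>; the rest bounds the opcode
  \<open>3 + r\<close>, whose \<open>r + 4\<close> bits are fewer than
  \<open>length Ms + 4\<close>.\<close>

definition step_cost :: real where
  "step_cost = 9 * real (max_premises P) + real (length Ms) + 4"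

text \<open>The machine stores new formulas in front, so its pool is not in the order of the trace.
  A trace index is replaced by any position holding the same code, for which equal sets suffice, and
  equal lengths keep positions below \<open>L\<close>. The quantified \<open>rest\<close> leaves
  room for further code, in the end the selection of the output.\<close>

lemma replay_code:
  assumes "replay P pool steps = Some pool'" "set pool \<subseteq> FO_LFP \<Sigma>"
    and "set Q = enc A ` set pool" "length Q = length pool"
    and "real (length pool + length steps) \<le> L" "2 \<le> L"
  shows "\<exists>ops Q'. (\<forall>rest t. exec (main_loop Ms) (vm_state Q' 0 [] rest) t \<longrightarrow>
        exec (main_loop Ms) (vm_state Q 0 [] (ops @ rest)) t) \<and>
      set Q' = enc A ` set pool' \<and> length Q' = length pool' \<and>
      length pool' = length pool + length steps \<and>
      real (length ops) \<le> real (length steps) * (step_cost * log 2 L)"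
  using assms(1-5)
proof (induction steps arbitrary: pool Q)
  case Nil
  then show ?case by (intro exI[of _ "[]"] exI[of _ Q]) auto
next
  case (Cons st steps)
  obtain r "is" where st: "st = (r, is)" by (cases st)
  have r: "r \<in> rules P" and idx: "\<forall>i\<in>set is. i < length pool"
    using Cons.prems(1) st by (auto split: if_splits)
  obtain \<phi> where \<phi>: "conclusion P r (map ((!) pool) is) = Some \<phi>"
    "replay P (pool @ [\<phi>]) steps = Some pool'"
    using Cons.prems(1) st by (auto split: if_splits option.splits)
  let ?ps = "map ((!) pool) is"
  have ps: "set ?ps \<subseteq> FO_LFP \<Sigma>" using idx Cons.prems(2) by auto
  then have arity: "length ?ps \<le> max_premises P" and conc: "\<phi> \<in> FO_LFP \<Sigma>"
    using calculus r \<phi>(1) unfolding effective_calculus_def by blast+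
  have "\<forall>i\<in>set is. \<exists>n. n < length Q \<and> Q ! n = enc A (pool ! i)"
  proof
    fix i assume "i \<in> set is"
    then have "enc A (pool ! i) \<in> set Q" using idx Cons.prems(3) by auto
    then show "\<exists>n. n < length Q \<and> Q ! n = enc A (pool ! i)" by (auto simp: in_set_conv_nth)
  qed
  then obtain pos where pos: "\<forall>i\<in>set is. pos i < length Q \<and> Q ! pos i = enc A (pool ! i)"
    by metis
  define ns where "ns = map pos is"
  have ns: "\<forall>n\<in>set ns. n < length Q" and sel: "map ((!) Q) ns = map (enc A) ?ps"
    using pos by (auto simp: ns_def)
  let ?Q = "enc A \<phi> # Q"
  have "set ?Q = enc A ` set (pool @ [\<phi>])" "length ?Q = length (pool @ [\<phi>])"
    using Cons.prems(3,4) by auto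
  moreover have "set (pool @ [\<phi>]) \<subseteq> FO_LFP \<Sigma>" using conc Cons.prems(2) by simp
  moreover have "real (length (pool @ [\<phi>]) + length steps) \<le> L" using Cons.prems(5) by simp
  ultimately obtain ops Q' where IH:
    "\<forall>rest t. exec (main_loop Ms) (vm_state Q' 0 [] rest) t \<longrightarrow>
        exec (main_loop Ms) (vm_state ?Q 0 [] (ops @ rest)) t"
    "set Q' = enc A ` set pool'" "length Q' = length pool'"
    "length pool' = length (pool @ [\<phi>]) + length steps"
    "real (length ops) \<le> real (length steps) * (step_cost * log 2 L)"
    using Cons.IH[OF \<phi>(2), of ?Q] by blast
  let ?ops = "args_code ns @ opcode (3 + r) @ ops"
  have "exec (main_loop Ms) (vm_state Q 0 [] (?ops @ rest)) t"
    if "exec (main_loop Ms) (vm_state Q' 0 [] rest) t" for rest t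
  proof -
    have "tm_out (Ms ! r) [list_code (map ((!) Q) ns)] (True # enc A \<phi>)"
      using machines[OF r] ps \<phi>(1) unfolding sel by fastforce
    then have "exec (main_loop Ms)
        (vm_state Q 0 (list_code (map ((!) Q) ns)) (opcode (3 + r) @ ops @ rest)) t"
      using machines[OF r] IH(1) that by (intro main_loop_apply) auto
    then show ?thesis using main_loop_args[OF ns, of Ms "[]"] by simp
  qed
  moreover have "real (length ?ops) \<le> real (length (st # steps)) * (step_cost * log 2 L)"
  proof -
    have log: "1 \<le> log 2 L" using \<open>2 \<le> L\<close> by (rule one_le_log)
    have "\<forall>n\<in>set ns. real n < L" using ns Cons.prems(4,5) by force
    then have "real (length (args_code ns)) \<le> real (length ns) * (9 * log 2 L)"
      using \<open>2 \<le> L\<close> by (rule length_args_code)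
    also have "\<dots> \<le> real (max_premises P) * (9 * log 2 L)"
      using arity log by (intro mult_right_mono) (auto simp: ns_def)
    finally have args: "real (length (args_code ns)) \<le> 9 * real (max_premises P) * log 2 L"
      by simp
    have "real (length (opcode (3 + r))) \<le> (real (length Ms) + 4) * 1"
      using machines[OF r] by (simp add: opcode_def)
    also have "\<dots> \<le> (real (length Ms) + 4) * log 2 L"
      using log by (intro mult_left_mono) auto
    finally show ?thesis using args IH(5) by (simp add: step_cost_def algebra_simps)
  qed
  moreover have "length pool' = length pool + length (st # steps)" using IH(4) by simp
  ultimately show ?case using IH(2,3) by blast
qed

lemma derivation_program:
  assumes der: "derives P A B (steps, out) q"
    and N: "implements T N (interpreter M Ms)" "T \<ge> 9"
    and M: "tm_out M [y] (list_code (map (enc A) (listing A B)))"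
    and B: "set (listing A B) \<subseteq> FO_LFP \<Sigma>"
    and L: "L = real (length (listing A B) + length steps)" "2 \<le> L"
  shows "\<exists>p. tm_out N [p, y] (enc A q) \<and>
    real (length p) \<le> 2 * ((real (length steps) * step_cost + 9) * log 2 L) + 1"
proof -
  let ?Q = "map (enc A) (listing A B)"
  obtain pool where pool: "replay P (listing A B) steps = Some pool"
    "out < length pool" "pool ! out = q"
    using der by (auto simp: derives_def)
  obtain ops Q where ops:
    "\<forall>rest t. exec (main_loop Ms) (vm_state Q 0 [] rest) t \<longrightarrow>
        exec (main_loop Ms) (vm_state ?Q 0 [] (ops @ rest)) t"
    "set Q = enc A ` set pool" "length Q = length pool"
    "length pool = length (listing A B) + length steps"
    "real (length ops) \<le> real (length steps) * (step_cost * log 2 L)"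
    using replay_code[OF pool(1) B, of ?Q L] L by auto
  have "enc A q \<in> set Q" using ops(2) pool(2,3) by auto
  then obtain n where n: "n < length Q" "Q ! n = enc A q" by (auto simp: in_set_conv_nth)
  let ?s = "vm_state Q 0 (block (enc A q)) []"
  \<comment> \<open>The output formula is selected like an argument, which leaves its block on stack
    8, where \<open>emit\<close> expects it.\<close>
  let ?ops = "ops @ index_code n @ opcode 2"
  have "exec (main_loop Ms) ?s ?s"
    unfolding main_loop_def by (rule exec_While_False) (simp add: vm_state_def)
  then have "exec (main_loop Ms) (vm_state Q n [] (opcode 2 @ [])) ?s"
    using n by (intro main_loop_select) auto
  then have "exec (main_loop Ms) (vm_state Q 0 [] (index_code n @ opcode 2)) ?s"
    using main_loop_index[of Ms Q n "[]"] by simp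
  then have "exec (main_loop Ms) (vm_state ?Q 0 [] ?ops) ?s"
    using ops(1) by simp
  then have "tm_out N [double_bits (rev ?ops), y] (enc A q)"
    by (rule interpreter_outputs[OF N M])
  moreover have "real (length (index_code n @ opcode 2)) \<le> 9 * log 2 L"
    using n(1) ops(3,4) L by (intro length_select_code) auto
  then have "real (length (double_bits (rev ?ops))) \<le>
      2 * ((real (length steps) * step_cost + 9) * log 2 L) + 1"
    using ops(5) by (simp add: length_double_bits algebra_simps)
  ultimately show ?thesis by blast
qed

end

section \<open>The uniform bound on complexity\<close>

lemma Nsteps_attained:
  assumes "Nsteps P A B q = enat n"
  shows "\<exists>tr. derives P A B tr q \<and> length (fst tr) = n"
proof -
  let ?S = "(\<lambda>tr. enat (length (fst tr))) ` {tr. derives P A B tr q}"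
  have Inf: "Inf ?S = enat n" using assms by (simp add: Nsteps_def)
  \<comment> \<open>The infimum of the empty set is \<infinity>, so a finite value yields a trace;
    on a nonempty set of \<open>enat\<close> the infimum is attained.\<close>
  then have "?S \<noteq> {}" by (metis Inf_empty enat_ord_code(3) top_enat_def enat.distinct(1))
  then have "Inf ?S \<in> ?S"
    unfolding Inf_enat_def by (auto intro: LeastI)
  then show ?thesis using Inf by auto
qed

lemma Kcond_le: "tm_out U [p, y] x \<Longrightarrow> Kcond U x y \<le> length p"
  unfolding Kcond_def by (rule Least_le) blast

lemma ex_rule_machines:
  assumes "effective_calculus \<Sigma> A P" "wf_tm M"
  shows "\<exists>Ms. rule_machines \<Sigma> A P Ms \<and> (\<forall>N\<in>set Ms. wf_tm N)"
proof -
  let ?ok = "\<lambda>r N. wf_tm N \<and> (\<forall>ps. set ps \<subseteq> FO_LFP \<Sigma> \<longrightarrow>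
        tm_out N [list_code (map (enc A) ps)]
          (case conclusion P r ps of None \<Rightarrow> [] | Some \<phi> \<Rightarrow> True # enc A \<phi>))"
  have "\<forall>r\<in>rules P. \<exists>N. ?ok r N" using assms(1) unfolding effective_calculus_def by blast
  then obtain f where f: "\<forall>r\<in>rules P. ?ok r (f r)" by metis
  have "finite (rules P)" using assms(1) by (simp add: effective_calculus_def)
  then obtain R where R: "\<forall>r\<in>rules P. r < R" using finite_nat_set_iff_bounded by blast
  \<comment> \<open>Rule names index the list directly; numbers below \<open>R\<close> that name no
    rule get \<open>M\<close> as a placeholder.\<close>
  let ?Ms = "map (\<lambda>r. if r \<in> rules P then f r else M) [0..<R]"
  have "rule_machines \<Sigma> A P ?Ms"
    using assms(1) f R by unfold_locales auto
  moreover have "\<forall>N\<in>set ?Ms. wf_tm N" using f assms(2) by auto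
  ultimately show ?thesis by blast
qed

text \<open>The machine is built before any instance is given, so \<open>a\<close> is uniform. The
  factor \<open>n + 1\<close> pays for selecting the output, which costs bits even when
  \<open>n = 0\<close>.\<close>

lemma complexity_le_trace_length:
  assumes states: "effective_states \<Sigma> A" and calc: "effective_calculus \<Sigma> A P"
    and bases: "effective_bases A" and U: "universal U"
  shows "\<exists>a \<ge> 0. \<forall>B q n. premise_base A B \<longrightarrow> Nsteps P A B q = enat n \<longrightarrow> card B + n \<ge> 2 \<longrightarrow>
    Kq U A B q \<le> a * ((real n + 1) * log 2 (real (card B) + real n))"
proof -
  obtain M where M: "wf_tm M"
    "\<forall>B. premise_base A B \<longrightarrow> tm_out M [code A B] (list_code (map (enc A) (listing A B)))"
    using bases by (auto simp: effective_bases_def)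
  obtain Ms where Ms: "rule_machines \<Sigma> A P Ms" "\<forall>N\<in>set Ms. wf_tm N"
    using ex_rule_machines[OF calc M(1)] by blast
  interpret rule_machines \<Sigma> A P Ms by (rule Ms(1))
  \<comment> \<open>Called machines start on tape 8; the sum serves as an upper bound for all their
    tape counts.\<close>
  define T where "T = 8 + sum_list (map tapes (M # Ms))"
  have tapes: "\<forall>N\<in>set (M # Ms). 8 + tapes N \<le> T"
  proof
    fix N assume "N \<in> set (M # Ms)"
    then have "tapes N \<le> sum_list (map tapes (M # Ms))" by (intro member_le_sum_list) auto
    then show "8 + tapes N \<le> T" by (simp add: T_def)
  qed
  have "tapes M \<ge> 1" using M(1) by (simp add: wf_tm_def)
  then have T: "T \<ge> 9" using tapes by auto
  have "wf_prog T (interpreter M Ms)" using M(1) Ms(2) tapes by (rule wf_interpreter)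
  then obtain N where N: "implements T N (interpreter M Ms)" using compile by blast
  obtain w where w: "\<forall>p y x. tm_out U [w @ p, y] x \<longleftrightarrow> tm_out N [p, y] x"
    using U interpreter_prefix_machine[OF N T] unfolding universal_def by blast
  \<comment> \<open>\<open>w\<close> makes \<open>U\<close> simulate the interpreter, the 1 is the
    closing bit of \<open>double_bits\<close>, the 2 its flags, and the 9 the selection of the
    output.\<close>
  define a where "a = real (length w) + 1 + 2 * (step_cost + 9)"
  have cost: "step_cost \<ge> 0" by (simp add: step_cost_def)
  have "Kq U A B q \<le> a * ((real n + 1) * log 2 (real (card B) + real n))"
    if B: "premise_base A B" and n: "Nsteps P A B q = enat n" and two: "card B + n \<ge> 2" for B q n
  proof -
    obtain steps out where tr: "derives P A B (steps, out) q" "length steps = n"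
      using Nsteps_attained[OF n] by auto
    have listing: "set (listing A B) = B" "distinct (listing A B)"
      using bases B by (auto simp: effective_bases_def)
    then have card: "length (listing A B) = card B" by (metis distinct_card)
    have sub: "set (listing A B) \<subseteq> FO_LFP \<Sigma>"
      using listing(1) B states by (auto simp: premise_base_def effective_states_def)
    let ?l = "log 2 (real (card B) + real n)"
    obtain p where p: "tm_out N [p, code A B] (enc A q)"
      "real (length p) \<le> 2 * ((real n * step_cost + 9) * ?l) + 1"
      using derivation_program[OF tr(1) N T M(2)[rule_format, OF B] sub refl]
      unfolding card tr(2) using two by auto
    have "Kcond U (enc A q) (code A B) \<le> length (w @ p)"
      using w p(1) by (intro Kcond_le) blast
    then have "Kq U A B q \<le> real (length w) + 1 + 2 * ((real n * step_cost + 9) * ?l)"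
      using p(2) unfolding Kq_def by (simp flip: of_nat_add)
    also have "\<dots> \<le> a * ((real n + 1) * ?l)"
    proof -
      have "1 \<le> ?l" using two by (intro one_le_log) linarith
      then have l: "1 \<le> (real n + 1) * ?l" "0 \<le> ?l"
        using mult_mono[of 1 "real n + 1" 1 ?l] by auto
      have "real (length w) + 1 \<le> (real (length w) + 1) * ((real n + 1) * ?l)"
        using mult_left_mono[OF l(1), of "real (length w) + 1"] by simp
      moreover have "real n * step_cost + 9 \<le> (step_cost + 9) * (real n + 1)"
        using cost by (simp add: algebra_simps)
      then have "(real n * step_cost + 9) * ?l \<le> (step_cost + 9) * ((real n + 1) * ?l)"
        using l(2) by (metis mult.assoc mult_right_mono)
      ultimately show ?thesis unfolding a_def by (simp add: distrib_right)
    qed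
    finally show ?thesis .
  qed
  moreover have "a \<ge> 0" using cost by (simp add: a_def)
  ultimately show ?thesis by blast
qed

text \<open>Since \<open>m + y \<le> c * (m + x)\<close>, the exchange costs an additive
  \<open>log 2 c\<close>, which turns into a factor because \<open>log 2 (m + x) \<ge> 1\<close>. It
  trades trace length for depth inside the logarithm, in either direction.\<close>

lemma log_add_le_scaled:
  fixes m x y c :: real
  assumes "c \<ge> 1" "m \<ge> 0" "y \<le> c * x" "m + y \<ge> 2" "m + x \<ge> 2"
  shows "log 2 (m + y) \<le> (1 + log 2 c) * log 2 (m + x)"
proof -
  have "m \<le> c * m" using assms(1,2) by (simp add: mult_le_cancel_right1)
  then have "log 2 (m + y) \<le> log 2 (c * (m + x))"
    using assms by (intro log_mono) (auto simp: distrib_left)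
  also have "\<dots> = log 2 c * 1 + log 2 (m + x)"
    using assms by (simp add: log_mult)
  also have "\<dots> \<le> log 2 c * log 2 (m + x) + log 2 (m + x)"
    using assms by (intro add_right_mono mult_left_mono) (auto simp: le_log_iff)
  finally show ?thesis by (simp add: algebra_simps)
qed

theorem mainTheorem3:
  fixes \<Sigma> :: signature and P :: calculus and A :: ambient and U :: tm
    and cmin cmax :: real
  assumes "effective_states \<Sigma> A"
    and "effective_calculus \<Sigma> A P"
    and "effective_unfolding A"
    and "effective_bases A"
    and "universal U"
    and "cmin > 0" and "cmax > 0"
  shows "\<exists>c\<^sub>1 > 0. \<exists>c\<^sub>2 > 0. \<forall>C pb.
    instance_class P A C \<and> serializable P A cmin cmax C \<longrightarrow>
    (\<forall>(q, B) \<in> admissible P A pb C.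
       Kq U A B q \<le> c\<^sub>1 * (real (Dd A B q) * log_size A B q) \<and>
       real (Dd A B q) \<ge> Kq U A B q / (c\<^sub>1 * log_size A B q)) \<and>
    (\<forall>\<delta>\<^sub>0 \<delta>. 0 < \<delta>\<^sub>0 \<and> \<delta>\<^sub>0 < \<delta> \<and> \<delta> < 1 \<and> rich P A pb \<delta>\<^sub>0 \<longrightarrow>
       (\<forall>(q, B) \<in> admissible P A pb C \<inter> generic P A U \<delta>.
          real (Dd A B q) \<le> Kq U A B q / (c\<^sub>2 * (1 - \<delta>) * log_size A B q)) \<and>
       (\<lambda>(q, B). real (Dd A B q))
         \<in> \<Theta>[principal (admissible P A pb C \<inter> generic P A U \<delta>)](\<lambda>(q, B). Kq U A B q / log_size A B q) \<and>
       (\<lambda>(q, B). H_derive A B q)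
         \<in> \<Theta>[principal (admissible P A pb C \<inter> generic P A U \<delta>)](\<lambda>(q, B). H_K U A B q / log_size A B q) \<and>
       (\<lambda>(q, B). Kq U A B q)
         \<in> \<Theta>[principal (admissible P A pb C \<inter> generic P A U \<delta>)](\<lambda>(q, B). real (Dd A B q) * log_size A B q))"
proof -
  obtain a where a: "a \<ge> 0" and K_le: "\<And>B q n. premise_base A B \<Longrightarrow> Nsteps P A B q = enat n \<Longrightarrow>
      card B + n \<ge> 2 \<Longrightarrow> Kq U A B q \<le> a * ((real n + 1) * log 2 (real (card B) + real n))"
    using complexity_le_trace_length[OF assms(1,2,4,5)] by blast
  \<comment> \<open>\<open>s\<close> will bound n / d and \<open>r\<close> will bound d / n; both
    are raised to at least 1, as \<open>log_add_le_scaled\<close> requires.\<close>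
  define s where "s = max 1 cmax"
  define r where "r = max 1 (1 / cmin)"
  \<comment> \<open>From \<open>n + 1 \<le> 2 * s * d\<close> and the factor
    \<open>1 + log 2 s\<close> for the logarithm; the final 1 keeps the constant positive when
    \<open>a = 0\<close>.\<close>
  define c\<^sub>1 where "c\<^sub>1 = a * (2 * s) * (1 + log 2 s) + 1"
  \<comment> \<open>From \<open>cmin * d \<le> n\<close>, divided by the loss in passing from
    \<open>log 2 (m + d)\<close> to \<open>log 2 (m + n)\<close>.\<close>
  define c\<^sub>2 where "c\<^sub>2 = cmin / (1 + log 2 r)"
  have s: "s \<ge> 1" "s \<ge> cmax" and r: "r \<ge> 1" "r \<ge> 1 / cmin" by (auto simp: s_def r_def)
  have logs: "log 2 s \<ge> 0" "log 2 r \<ge> 0" using s r by auto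
  have c: "c\<^sub>1 > 0" "c\<^sub>2 > 0"
    using a s logs assms(6) by (auto simp: c\<^sub>1_def c\<^sub>2_def intro!: add_nonneg_pos mult_nonneg_nonneg)
  have bounds: "log_size A B q \<ge> 1" "Dd A B q \<ge> 1"
      "Kq U A B q \<le> c\<^sub>1 * (real (Dd A B q) * log_size A B q)"
      "(q, B) \<in> generic P A U \<delta> \<Longrightarrow> \<delta> < 1 \<Longrightarrow>
        c\<^sub>2 * (1 - \<delta>) * (real (Dd A B q) * log_size A B q) \<le> Kq U A B q"
    if inst: "instance_class P A C" and ser: "serializable P A cmin cmax C"
      and adm: "(q, B) \<in> admissible P A pb C" for C pb q B \<delta>
  proof -
    let ?m = "real (card B)" and ?d = "real (Dd A B q)"
    have qB: "(q, B) \<in> C" "B \<noteq> {}" "q \<in> Cn P B" and d: "Dd A B q \<ge> 1"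
      using adm by (auto simp: admissible_def)
    have B: "premise_base A B" using inst qB(1) by (auto simp: instance_class_def)
    then have m: "?m \<ge> 1" using qB(2) by (simp add: premise_base_def Suc_leI card_gt_0_iff)
    obtain n where n: "Nsteps P A B q = enat n" "cmin * ?d \<le> real n" "real n \<le> cmax * ?d"
      using ser qB(1,3) by (force simp: serializable_def)
    \<comment> \<open>Positive depth forces a nonempty trace; together with \<open>m \<ge> 1\<close>
      this puts \<open>m + n\<close> and \<open>m + d\<close> at 2 or more.\<close>
    have "0 < cmin * ?d" using assms(6) d by simp
    then have "real n > 0" using n(2) by linarith
    then have n1: "real n \<ge> 1" by simp
    have d1: "?d \<ge> 1" using d by simp
    have size: "log_size A B q = log 2 (?m + ?d)" by (simp add: log_size_def)
    show l1: "log_size A B q \<ge> 1" unfolding size using m d1 by (intro one_le_log) linarith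
    show "Dd A B q \<ge> 1" by (rule d)
    show "Kq U A B q \<le> c\<^sub>1 * (?d * log_size A B q)"
    proof -
      have nd: "real n \<le> s * ?d" using n(3) s(2) mult_right_mono[of cmax s ?d] by linarith
      then have "log 2 (?m + real n) \<le> (1 + log 2 s) * log_size A B q"
        unfolding size using m n1 d1 s by (intro log_add_le_scaled) auto
      moreover have "real n + 1 \<le> 2 * s * ?d"
        using nd mult_mono[of 1 s 1 ?d] s(1) d1 by simp
      ultimately have "(real n + 1) * log 2 (?m + real n) \<le>
          (2 * s * ?d) * ((1 + log 2 s) * log_size A B q)"
        using m n1 s d1 by (intro mult_mono) auto
      then have "a * ((real n + 1) * log 2 (?m + real n)) \<le>
          a * ((2 * s * ?d) * ((1 + log 2 s) * log_size A B q))"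
        using a by (rule mult_left_mono)
      moreover have "Kq U A B q \<le> a * ((real n + 1) * log 2 (?m + real n))"
        using B n(1) by (rule K_le) (use m n1 in linarith)
      moreover have "0 \<le> ?d * log_size A B q" using l1 by simp
      ultimately show ?thesis by (simp add: c\<^sub>1_def algebra_simps)
    qed
    assume gen: "(q, B) \<in> generic P A U \<delta>" and \<delta>: "\<delta> < 1"
    have gen: "(1 - \<delta>) * real n * log 2 (?m + real n) \<le> Kq U A B q"
      using gen n(1) by (auto simp: generic_def)
    have "?d \<le> 1 / cmin * real n" using n(2) assms(6) by (simp add: field_simps)
    also have "\<dots> \<le> r * real n" using r(2) by (rule mult_right_mono) simp
    finally have "log_size A B q \<le> (1 + log 2 r) * log 2 (?m + real n)"
      unfolding size using m n1 d1 r by (intro log_add_le_scaled) auto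
    then have "log_size A B q / (1 + log 2 r) \<le> log 2 (?m + real n)"
      using logs(2) by (simp add: divide_le_eq mult.commute)
    then have "(cmin * ?d) * (log_size A B q / (1 + log 2 r)) \<le> real n * log 2 (?m + real n)"
      using n(2) l1 logs(2) by (intro mult_mono) auto
    then have "(1 - \<delta>) * ((cmin * ?d) * (log_size A B q / (1 + log 2 r))) \<le>
        (1 - \<delta>) * (real n * log 2 (?m + real n))"
      using \<delta> by (intro mult_left_mono) auto
    moreover have "c\<^sub>2 * (1 - \<delta>) * (?d * log_size A B q) =
        (1 - \<delta>) * ((cmin * ?d) * (log_size A B q / (1 + log 2 r)))"
      by (simp add: c\<^sub>2_def)
    ultimately show "c\<^sub>2 * (1 - \<delta>) * (?d * log_size A B q) \<le> Kq U A B q"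
      using gen by (simp add: mult.assoc)
  qed
  show ?thesis
  proof (rule exI[of _ c\<^sub>1], rule conjI[OF c(1)], rule exI[of _ c\<^sub>2], rule conjI[OF c(2)],
      intro allI impI conjI)
    fix C pb
    assume "instance_class P A C \<and> serializable P A cmin cmax C"
    then have C: "instance_class P A C" "serializable P A cmin cmax C" by auto
    have depth_ge: "Kq U A B q / (c\<^sub>1 * log_size A B q) \<le> real (Dd A B q)"
      if "(q, B) \<in> admissible P A pb C" for q B
      using bounds(1,3)[OF C that] c(1) by (simp add: divide_le_eq mult_ac)
    show "\<forall>(q, B) \<in> admissible P A pb C.
       Kq U A B q \<le> c\<^sub>1 * (real (Dd A B q) * log_size A B q) \<and>
       real (Dd A B q) \<ge> Kq U A B q / (c\<^sub>1 * log_size A B q)"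
      using bounds(3)[OF C] depth_ge by blast
    fix \<delta>\<^sub>0 \<delta> :: real
    assume "0 < \<delta>\<^sub>0 \<and> \<delta>\<^sub>0 < \<delta> \<and> \<delta> < 1 \<and> rich P A pb \<delta>\<^sub>0"
    then have \<delta>: "\<delta> < 1" by simp
    let ?G = "admissible P A pb C \<inter> generic P A U \<delta>"
    let ?c = "c\<^sub>2 * (1 - \<delta>)"
    have c': "?c > 0" using c(2) \<delta> by simp
    have depth_le: "real (Dd A B q) \<le> Kq U A B q / (?c * log_size A B q)"
      if "(q, B) \<in> ?G" for q B
    proof -
      have adm: "(q, B) \<in> admissible P A pb C" and gen: "(q, B) \<in> generic P A U \<delta>"
        using that by auto
      have "0 < ?c * log_size A B q" using bounds(1)[OF C adm] by (intro mult_pos_pos[OF c']) simp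
      then show ?thesis
        using bounds(4)[OF C adm gen \<delta>] by (simp only: pos_le_divide_eq) (simp add: mult_ac)
    qed
    show "\<forall>(q, B) \<in> ?G. real (Dd A B q) \<le> Kq U A B q / (c\<^sub>2 * (1 - \<delta>) * log_size A B q)"
      using depth_le by blast
    have log_pos: "log_size A B q > 0" if "(q, B) \<in> ?G" for q B
      using that bounds(1)[OF C, of q B pb] by force
    \<comment> \<open>On a principal filter, eventually means everywhere on \<open>?G\<close>, so
      each Theta is a two-sided bound without exceptional instances.\<close>
    have ThetaI: "(\<lambda>(q, B). f q B) \<in> \<Theta>[principal ?G](\<lambda>(q, B). g q B)"
      if "k > 0" "k' > 0"
        "\<And>q B. (q, B) \<in> ?G \<Longrightarrow> k * \<bar>g q B\<bar> \<le> \<bar>f q B\<bar> \<and> \<bar>f q B\<bar> \<le> k' * \<bar>g q B\<bar>"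
      for f g :: "fml \<Rightarrow> fml set \<Rightarrow> real" and k k'
      by (rule bigthetaI'[OF that(1,2)]) (use that(3) in \<open>auto simp: eventually_principal\<close>)
    have depth: "1 / c\<^sub>1 * \<bar>Kq U A B q / log_size A B q\<bar> \<le> \<bar>real (Dd A B q)\<bar> \<and>
        \<bar>real (Dd A B q)\<bar> \<le> 1 / ?c * \<bar>Kq U A B q / log_size A B q\<bar>"
      if "(q, B) \<in> ?G" for q B
    proof -
      have "Kq U A B q / log_size A B q \<ge> 0" using log_pos[OF that] by (simp add: Kq_def)
      then have "\<bar>Kq U A B q / log_size A B q\<bar> = Kq U A B q / log_size A B q"
        by (rule abs_of_nonneg)
      then show ?thesis
        using depth_ge[of q B] depth_le[OF that] that by (simp del: abs_divide)
    qed
    show "(\<lambda>(q, B). real (Dd A B q)) \<in> \<Theta>[principal ?G](\<lambda>(q, B). Kq U A B q / log_size A B q)"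
      by (rule ThetaI[OF _ _ depth]) (use c c' in auto)
    show "(\<lambda>(q, B). H_derive A B q)
         \<in> \<Theta>[principal ?G](\<lambda>(q, B). H_K U A B q / log_size A B q)"
    proof (rule ThetaI)
      fix q B assume "(q, B) \<in> ?G"
      note * = depth[OF this]
      have H: "\<bar>H_derive A B q\<bar> = \<bar>real (Dd A B q)\<bar> * ln 2"
        "\<bar>H_K U A B q / log_size A B q\<bar> = \<bar>Kq U A B q / log_size A B q\<bar> * ln 2"
        by (simp_all add: H_derive_def H_K_def abs_mult)
      show "1 / c\<^sub>1 * \<bar>H_K U A B q / log_size A B q\<bar> \<le> \<bar>H_derive A B q\<bar> \<and>
          \<bar>H_derive A B q\<bar> \<le> 1 / ?c * \<bar>H_K U A B q / log_size A B q\<bar>"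
        unfolding H mult.assoc[symmetric] using * by (intro conjI mult_right_mono) auto
    qed (use c c' in auto)
    show "(\<lambda>(q, B). Kq U A B q)
         \<in> \<Theta>[principal ?G](\<lambda>(q, B). real (Dd A B q) * log_size A B q)"
    \<comment> \<open>With complexity on the left the constants change sides: genericity supplies
      the lower one, the encoding of traces the upper one.\<close>
    proof (rule ThetaI[OF c' c(1)])
      fix q B assume G: "(q, B) \<in> ?G"
      then have "?c * (real (Dd A B q) * log_size A B q) \<le> Kq U A B q"
        "Kq U A B q \<le> c\<^sub>1 * (real (Dd A B q) * log_size A B q)"
        using bounds(3,4)[OF C] \<delta> by blast+
      moreover have "\<bar>real (Dd A B q) * log_size A B q\<bar> = real (Dd A B q) * log_size A B q"
        using log_pos[OF G] by simp
      moreover have "\<bar>Kq U A B q\<bar> = Kq U A B q" by (simp add: Kq_def)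
      ultimately show "?c * \<bar>real (Dd A B q) * log_size A B q\<bar> \<le> \<bar>Kq U A B q\<bar> \<and>
          \<bar>Kq U A B q\<bar> \<le> c\<^sub>1 * \<bar>real (Dd A B q) * log_size A B q\<bar>"
        by simp
    qed
  qed
qed

end
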